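(* Let $p\in[1,\infty]$, and let $E$ be a locally convex space. Then the following assertions are equivalent: (i) for every normed space $Y$, if $T:Y\to E$ is an operator such that the adjoint operator $T^\ast:E'_\beta\to Y'_\beta$ is $p$-convergent, then $T$ is weakly sequentially precompact (resp., weakly sequentially compact); (ii) the same as (i) with $Y=\ell_1^0$; (iii) the space $E$ has the property $wsV^\ast_p$ (resp., the property $sV^\ast_p$). If additionally $E$ is locally complete, then (i)--(iii) are equivalent to (iv) the same as (i) with $Y=\ell_1$.
   Context: All locally convex spaces are Hausdorff, over $\mathbb{F}\in\{\mathbb{R},\mathbb{C}\}$. The statement consists of two versions: one with the first alternatives and one with the alternatives after "resp.". An operator is a continuous linear map. $E'_\beta$ is the dual $E'$ with the strong topology $\beta(E',E)$. $\ell_1^0$ is the linear span of the canonical unit vectors in $\ell_1$, with the induced norm. $E$ is locally complete if the closed absolutely convex hull of every null sequence in $E$ is compact. A sequence $\{x_n\}_{n\in\omega}$ in a locally convex space $F$ is weakly $p$-summable if $(\langle\chi,x_n\rangle)_n\in\ell_p$ (or $\in c_0$ if $p=\infty$) for every $\chi\in F'$. A linear map is $p$-convergent if it sends weakly $p$-summable sequences to null sequences. A non-empty subset $A$ of $E$ is a $p$-$(V^\ast)$ set if $\lim_n\sup_{a\in A}|\langle\chi_n,a\rangle|=0$ for every weakly $p$-summable sequence $\{\chi_n\}$ in $E'_\beta$. A subset $A$ of $E$ is weakly sequentially precompact if every sequence in $A$ has a weakly Cauchy subsequence, and relatively weakly sequentially compact if every sequence in $A$ has a subsequence weakly converging to a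 point of $E$. $E$ has the property $wsV^\ast_p$ (resp. $sV^\ast_p$) if every $p$-$(V^\ast)$ set in $E$ is weakly sequentially precompact (resp. relatively weakly sequentially compact). An operator $T:Y\to E$ is weakly sequentially precompact (resp. weakly sequentially compact) if for some neighborhood $U$ of zero in $Y$ the set $T(U)$ is weakly sequentially precompact (resp. relatively weakly sequentially compact) in $E$. *)

theory Defs
  imports "HOL-Analysis.Analysis" "HOL-Algebra.Module" "HOL-Library.Equipollence"
begin

text \<open>
  The scalar field is a type \<open>'k\<close> of the following class: up to an isometric field isomorphism it
  is either \<open>real\<close> or \<open>complex\<close>.
\<close>

class real_or_complex = real_normed_field +
  assumes isometric_to_real_or_complex:
    "(\<exists>h :: 'a \<Rightarrow> real. bij h \<and> (\<forall>x y. h (x + y) = h x + h y) \<and> (\<forall>x y. h (x * y) = h x * h y)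
        \<and> (\<forall>x. norm (h x) = norm x)) \<or>
     (\<exists>h :: 'a \<Rightarrow> complex. bij h \<and> (\<forall>x y. h (x + y) = h x + h y) \<and> (\<forall>x y. h (x * y) = h x * h y)
        \<and> (\<forall>x. norm (h x) = norm x))"

instance real :: real_or_complex
  by standard (rule disjI1, rule exI[of _ "\<lambda>x. x"], simp add: bij_def inj_def)

instance complex :: real_or_complex
  by standard (rule disjI2, rule exI[of _ "\<lambda>x. x"], simp add: bij_def inj_def)


section \<open>Locally convex spaces\<close>

text \<open>
  Spaces are carrier-based, because the theorem quantifies over all normed spaces and passes to
  dual spaces. The record extends the modules of HOL-Algebra; its ring multiplication and its
  ring unit (\<open>mult\<close>, \<open>one\<close>) play no role for a module.
\<close>

record ('k, 'a) tvs = "('k, 'a) module" +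
  topo :: "'a topology"

text \<open>The scalar field, used both as the ring of scalars and as a space over itself.\<close>

definition scalar_space :: "('k::real_or_complex, 'k) tvs" where
  "scalar_space = \<lparr>carrier = UNIV, mult = (*), one = 1, zero = 0, add = (+),
     smult = (*), topo = euclidean\<rparr>"

definition vector_space_on :: "('k::real_or_complex, 'a) tvs \<Rightarrow> bool" where
  "vector_space_on E \<longleftrightarrow> Module.module (scalar_space :: ('k, 'k) tvs) E"

definition convex_in :: "('k::real_or_complex, 'a) tvs \<Rightarrow> 'a set \<Rightarrow> bool" where
  "convex_in E C \<longleftrightarrow> C \<subseteq> carrier E \<and>
     (\<forall>x\<in>C. \<forall>y\<in>C. \<forall>t::real. 0 \<le> t \<and> t \<le> 1 \<longrightarrow>
        (of_real (1 - t) \<odot>\<^bsub>E\<^esub> x) \<oplus>\<^bsub>E\<^esub> (of_real t \<odot>\<^bsub>E\<^esub> y) \<in> C)"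

definition locally_convex_space :: "('k::real_or_complex, 'a) tvs \<Rightarrow> bool" where
  "locally_convex_space E \<longleftrightarrow>
     vector_space_on E \<and>
     topspace (topo E) = carrier E \<and>
     Hausdorff_space (topo E) \<and>
     continuous_map (prod_topology (topo E) (topo E)) (topo E) (\<lambda>(x, y). x \<oplus>\<^bsub>E\<^esub> y) \<and>
     continuous_map (prod_topology euclidean (topo E)) (topo E) (\<lambda>(c, x). c \<odot>\<^bsub>E\<^esub> x) \<and>
     (\<forall>U. openin (topo E) U \<and> \<zero>\<^bsub>E\<^esub> \<in> U \<longrightarrow>
        (\<exists>V. openin (topo E) V \<and> \<zero>\<^bsub>E\<^esub> \<in> V \<and> V \<subseteq> U \<and> convex_in E V))"

definition zero_nbhd :: "('k::real_or_complex, 'a) tvs \<Rightarrow> 'a set \<Rightarrow> bool" where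
  "zero_nbhd E U \<longleftrightarrow> U \<subseteq> carrier E \<and> \<zero>\<^bsub>E\<^esub> \<in> topo E interior_of U"

definition bounded_in :: "('k::real_or_complex, 'a) tvs \<Rightarrow> 'a set \<Rightarrow> bool" where
  "bounded_in E B \<longleftrightarrow> B \<subseteq> carrier E \<and>
     (\<forall>U. zero_nbhd E U \<longrightarrow> (\<exists>r>0. \<forall>c. norm c \<ge> r \<longrightarrow> B \<subseteq> (\<lambda>x. c \<odot>\<^bsub>E\<^esub> x) ` U))"

definition linear_map_on ::
  "('k::real_or_complex, 'a) tvs \<Rightarrow> ('k, 'b) tvs \<Rightarrow> ('a \<Rightarrow> 'b) \<Rightarrow> bool" where
  "linear_map_on E F T \<longleftrightarrow>
     T \<in> carrier E \<rightarrow> carrier F \<and>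
     (\<forall>x\<in>carrier E. \<forall>y\<in>carrier E. T (x \<oplus>\<^bsub>E\<^esub> y) = T x \<oplus>\<^bsub>F\<^esub> T y) \<and>
     (\<forall>c. \<forall>x\<in>carrier E. T (c \<odot>\<^bsub>E\<^esub> x) = c \<odot>\<^bsub>F\<^esub> T x)"

definition operator ::
  "('k::real_or_complex, 'a) tvs \<Rightarrow> ('k, 'b) tvs \<Rightarrow> ('a \<Rightarrow> 'b) \<Rightarrow> bool" where
  "operator E F T \<longleftrightarrow> linear_map_on E F T \<and> continuous_map (topo E) (topo F) T"


section \<open>Duality\<close>

text \<open>
  Functionals are extended by zero outside the carrier, so that two functionals that agree on the
  carrier are the same element of the dual.
\<close>

definition dual :: "('k::real_or_complex, 'a) tvs \<Rightarrow> ('a \<Rightarrow> 'k) set" where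
  "dual E = {f. operator E scalar_space f \<and> (\<forall>x. x \<notin> carrier E \<longrightarrow> f x = 0)}"

text \<open>
  The topology of uniform convergence on the bounded subsets. The sets
  \<open>{g. \<forall>b\<in>B. norm (g b - f b) \<le> \<epsilon>}\<close> are neighbourhoods of \<open>f\<close> but need not be open, so they
  serve as a neighbourhood base and not as generators.
\<close>

definition strong_topology :: "('k::real_or_complex, 'a) tvs \<Rightarrow> ('a \<Rightarrow> 'k) topology" where
  "strong_topology E = topology (\<lambda>W. W \<subseteq> dual E \<and>
     (\<forall>f\<in>W. \<exists>B \<epsilon>. bounded_in E B \<and> 0 < \<epsilon> \<and> {g \<in> dual E. \<forall>b\<in>B. norm (g b - f b) \<le> \<epsilon>} \<subseteq> W))"

lemma bounded_in_Un:
  assumes "bounded_in E A" "bounded_in E B"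
  shows "bounded_in E (A \<union> B)"
  unfolding bounded_in_def
proof (intro conjI allI impI)
  show "A \<union> B \<subseteq> carrier E"
    using assms by (auto simp: bounded_in_def)
  fix U assume U: "zero_nbhd E U"
  obtain r s where r: "r > 0" "\<forall>c. norm c \<ge> r \<longrightarrow> A \<subseteq> (\<lambda>x. c \<odot>\<^bsub>E\<^esub> x) ` U"
    and s: "s > 0" "\<forall>c. norm c \<ge> s \<longrightarrow> B \<subseteq> (\<lambda>x. c \<odot>\<^bsub>E\<^esub> x) ` U"
    using assms U unfolding bounded_in_def by meson
  show "\<exists>r>0. \<forall>c. norm c \<ge> r \<longrightarrow> A \<union> B \<subseteq> (\<lambda>x. c \<odot>\<^bsub>E\<^esub> x) ` U"
    using r s by (intro exI[of _ "max r s"]) auto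
qed

lemma bounded_in_empty: "bounded_in E {}"
  unfolding bounded_in_def by (simp, intro allI impI exI[of _ 1]) simp

lemma openin_strong_topology:
  "openin (strong_topology E) W \<longleftrightarrow> W \<subseteq> dual E \<and>
     (\<forall>f\<in>W. \<exists>B \<epsilon>. bounded_in E B \<and> 0 < \<epsilon> \<and> {g \<in> dual E. \<forall>b\<in>B. norm (g b - f b) \<le> \<epsilon>} \<subseteq> W)"
proof -
  let ?nb = "\<lambda>f B \<epsilon>. {g \<in> dual E. \<forall>b\<in>B. norm (g b - f b) \<le> \<epsilon>}"
  let ?L = "\<lambda>W. W \<subseteq> dual E \<and> (\<forall>f\<in>W. \<exists>B \<epsilon>. bounded_in E B \<and> 0 < \<epsilon> \<and> ?nb f B \<epsilon> \<subseteq> W)"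
  have "istopology ?L"
    unfolding istopology_def
  proof (intro conjI allI impI)
    fix S T assume S: "?L S" and T: "?L T"
    show "S \<inter> T \<subseteq> dual E" using S by blast
    show "\<forall>f\<in>S \<inter> T. \<exists>B \<epsilon>. bounded_in E B \<and> 0 < \<epsilon> \<and> ?nb f B \<epsilon> \<subseteq> S \<inter> T"
    proof
      fix f assume f: "f \<in> S \<inter> T"
      obtain A a where A: "bounded_in E A" "0 < a" "?nb f A a \<subseteq> S" using S f by blast
      obtain B b where B: "bounded_in E B" "0 < b" "?nb f B b \<subseteq> T" using T f by blast
      have "?nb f (A \<union> B) (min a b) \<subseteq> ?nb f A a \<inter> ?nb f B b" by auto
      then have "?nb f (A \<union> B) (min a b) \<subseteq> S \<inter> T" using A(3) B(3) by blast
      then show "\<exists>B \<epsilon>. bounded_in E B \<and> 0 < \<epsilon> \<and> ?nb f B \<epsilon> \<subseteq> S \<inter> T"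
        using A(1,2) B(1,2) bounded_in_Un[of E A B]
        by (intro exI[of _ "A \<union> B"] exI[of _ "min a b"]) simp
    qed
  next
    fix \<K> assume K: "\<forall>W\<in>\<K>. ?L W"
    show "\<Union>\<K> \<subseteq> dual E" using K by blast
    show "\<forall>f\<in>\<Union>\<K>. \<exists>B \<epsilon>. bounded_in E B \<and> 0 < \<epsilon> \<and> ?nb f B \<epsilon> \<subseteq> \<Union>\<K>"
    proof
      fix f assume "f \<in> \<Union>\<K>"
      then obtain W where W: "W \<in> \<K>" "f \<in> W" by blast
      then obtain B \<epsilon> where "bounded_in E B" "0 < \<epsilon>" "?nb f B \<epsilon> \<subseteq> W" using K by blast
      with W show "\<exists>B \<epsilon>. bounded_in E B \<and> 0 < \<epsilon> \<and> ?nb f B \<epsilon> \<subseteq> \<Union>\<K>" by blast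
    qed
  qed
  then show ?thesis
    by (simp add: strong_topology_def)
qed

lemma topspace_strong_topology: "topspace (strong_topology E) = dual E"
proof -
  have "openin (strong_topology E) (dual E)"
    unfolding openin_strong_topology
    by (intro conjI ballI exI[of _ "{}"] exI[of _ 1]) (simp_all add: bounded_in_empty)
  then show ?thesis
    using openin_strong_topology[of E "topspace (strong_topology E)"] openin_subset by auto
qed

definition strong_dual :: "('k::real_or_complex, 'a) tvs \<Rightarrow> ('k, 'a \<Rightarrow> 'k) tvs" where
  "strong_dual E = \<lparr>carrier = dual E, mult = undefined, one = undefined,
     zero = (\<lambda>x. 0), add = (\<lambda>f g x. f x + g x), smult = (\<lambda>c f x. c * f x),
     topo = strong_topology E\<rparr>"

definition adjoint_map ::
  "('k::real_or_complex, 'a) tvs \<Rightarrow> ('a \<Rightarrow> 'b) \<Rightarrow> ('b \<Rightarrow> 'k) \<Rightarrow> ('a \<Rightarrow> 'k)" where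
  "adjoint_map Y T \<phi> = (\<lambda>y. if y \<in> carrier Y then \<phi> (T y) else 0)"

text \<open>The weak topology: the coarsest one for which all functionals in the dual are continuous.\<close>

definition weak_topology :: "('k::real_or_complex, 'a) tvs \<Rightarrow> 'a topology" where
  "weak_topology E =
     topology_generated_by {{x \<in> carrier E. \<phi> x \<in> V} | \<phi> V. \<phi> \<in> dual E \<and> open V}"

definition weakly_Cauchy :: "('k::real_or_complex, 'a) tvs \<Rightarrow> (nat \<Rightarrow> 'a) \<Rightarrow> bool" where
  "weakly_Cauchy E x \<longleftrightarrow> range x \<subseteq> carrier E \<and>
     (\<forall>U. openin (weak_topology E) U \<and> \<zero>\<^bsub>E\<^esub> \<in> U \<longrightarrow>
        (\<exists>N. \<forall>m\<ge>N. \<forall>n\<ge>N. x m \<ominus>\<^bsub>E\<^esub> x n \<in> U))"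


section \<open>Local completeness\<close>

definition absolutely_convex_in :: "('k::real_or_complex, 'a) tvs \<Rightarrow> 'a set \<Rightarrow> bool" where
  "absolutely_convex_in E D \<longleftrightarrow> D \<subseteq> carrier E \<and>
     (\<forall>x\<in>D. \<forall>y\<in>D. \<forall>a b. norm a + norm b \<le> 1 \<longrightarrow> (a \<odot>\<^bsub>E\<^esub> x) \<oplus>\<^bsub>E\<^esub> (b \<odot>\<^bsub>E\<^esub> y) \<in> D)"

definition absolutely_convex_hull_in :: "('k::real_or_complex, 'a) tvs \<Rightarrow> 'a set \<Rightarrow> 'a set" where
  "absolutely_convex_hull_in E A = \<Inter>{D. absolutely_convex_in E D \<and> A \<subseteq> D}"

definition locally_complete :: "('k::real_or_complex, 'a) tvs \<Rightarrow> bool" where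
  "locally_complete E \<longleftrightarrow>
     (\<forall>x. range x \<subseteq> carrier E \<and> limitin (topo E) x \<zero>\<^bsub>E\<^esub> sequentially \<longrightarrow>
        compactin (topo E) (topo E closure_of absolutely_convex_hull_in E (range x)))"


section \<open>Weakly p-summable sequences and related properties\<close>

definition p_small :: "ereal \<Rightarrow> (nat \<Rightarrow> 'k::real_or_complex) \<Rightarrow> bool" where
  "p_small p a \<longleftrightarrow>
     (if p = \<infinity> then a \<longlonglongrightarrow> 0 else summable (\<lambda>n. norm (a n) powr real_of_ereal p))"

definition weakly_p_summable ::
  "ereal \<Rightarrow> ('k::real_or_complex, 'a) tvs \<Rightarrow> (nat \<Rightarrow> 'a) \<Rightarrow> bool" where
  "weakly_p_summable p F x \<longleftrightarrow>
     range x \<subseteq> carrier F \<and> (\<forall>\<phi>\<in>dual F. p_small p (\<lambda>n. \<phi> (x n)))"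

definition p_convergent ::
  "ereal \<Rightarrow> ('k::real_or_complex, 'a) tvs \<Rightarrow> ('k, 'b) tvs \<Rightarrow> ('a \<Rightarrow> 'b) \<Rightarrow> bool" where
  "p_convergent p F G S \<longleftrightarrow>
     (\<forall>x. weakly_p_summable p F x \<longrightarrow> limitin (topo G) (\<lambda>n. S (x n)) \<zero>\<^bsub>G\<^esub> sequentially)"

text \<open>The supremum is taken in \<open>ereal\<close>, since it may be infinite.\<close>

definition p_Vstar_set :: "ereal \<Rightarrow> ('k::real_or_complex, 'a) tvs \<Rightarrow> 'a set \<Rightarrow> bool" where
  "p_Vstar_set p E A \<longleftrightarrow> A \<noteq> {} \<and> A \<subseteq> carrier E \<and>
     (\<forall>\<phi>. weakly_p_summable p (strong_dual E) \<phi> \<longrightarrow>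
        (\<lambda>n. SUP a\<in>A. ereal (norm (\<phi> n a))) \<longlonglongrightarrow> 0)"

definition weakly_seq_precompact :: "('k::real_or_complex, 'a) tvs \<Rightarrow> 'a set \<Rightarrow> bool" where
  "weakly_seq_precompact E A \<longleftrightarrow> A \<subseteq> carrier E \<and>
     (\<forall>x :: nat \<Rightarrow> 'a. range x \<subseteq> A \<longrightarrow> (\<exists>r :: nat \<Rightarrow> nat. strict_mono r \<and> weakly_Cauchy E (x \<circ> r)))"

definition rel_weakly_seq_compact :: "('k::real_or_complex, 'a) tvs \<Rightarrow> 'a set \<Rightarrow> bool" where
  "rel_weakly_seq_compact E A \<longleftrightarrow> A \<subseteq> carrier E \<and>
     (\<forall>x :: nat \<Rightarrow> 'a. range x \<subseteq> A \<longrightarrow>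
        (\<exists>r :: nat \<Rightarrow> nat. strict_mono r \<and> (\<exists>l\<in>carrier E. limitin (weak_topology E) (x \<circ> r) l sequentially)))"

definition property_wsVstar :: "ereal \<Rightarrow> ('k::real_or_complex, 'a) tvs \<Rightarrow> bool" where
  "property_wsVstar p E \<longleftrightarrow> (\<forall>A. p_Vstar_set p E A \<longrightarrow> weakly_seq_precompact E A)"

definition property_sVstar :: "ereal \<Rightarrow> ('k::real_or_complex, 'a) tvs \<Rightarrow> bool" where
  "property_sVstar p E \<longleftrightarrow> (\<forall>A. p_Vstar_set p E A \<longrightarrow> rel_weakly_seq_compact E A)"

definition weakly_seq_precompact_operator ::
  "('k::real_or_complex, 'y) tvs \<Rightarrow> ('k, 'a) tvs \<Rightarrow> ('y \<Rightarrow> 'a) \<Rightarrow> bool" where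
  "weakly_seq_precompact_operator Y E T \<longleftrightarrow>
     operator Y E T \<and> (\<exists>U. zero_nbhd Y U \<and> weakly_seq_precompact E (T ` U))"

definition weakly_seq_compact_operator ::
  "('k::real_or_complex, 'y) tvs \<Rightarrow> ('k, 'a) tvs \<Rightarrow> ('y \<Rightarrow> 'a) \<Rightarrow> bool" where
  "weakly_seq_compact_operator Y E T \<longleftrightarrow>
     operator Y E T \<and> (\<exists>U. zero_nbhd Y U \<and> rel_weakly_seq_compact E (T ` U))"


section \<open>Normed spaces\<close>

definition norm_on :: "('k::real_or_complex, 'a) tvs \<Rightarrow> ('a \<Rightarrow> real) \<Rightarrow> bool" where
  "norm_on Y N \<longleftrightarrow>
     (\<forall>x\<in>carrier Y. 0 \<le> N x \<and> (N x = 0 \<longleftrightarrow> x = \<zero>\<^bsub>Y\<^esub>)) \<and>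
     (\<forall>c. \<forall>x\<in>carrier Y. N (c \<odot>\<^bsub>Y\<^esub> x) = norm c * N x) \<and>
     (\<forall>x\<in>carrier Y. \<forall>y\<in>carrier Y. N (x \<oplus>\<^bsub>Y\<^esub> y) \<le> N x + N y)"

text \<open>
  The value 0 off the carrier only serves the locale \<open>Metric_space\<close>, which requires a distance to be
  nonnegative and symmetric on the whole type.
\<close>

definition norm_topology :: "('k::real_or_complex, 'a) tvs \<Rightarrow> ('a \<Rightarrow> real) \<Rightarrow> 'a topology" where
  "norm_topology Y N = Metric_space.mtopology (carrier Y)
     (\<lambda>x y. if x \<in> carrier Y \<and> y \<in> carrier Y then N (x \<ominus>\<^bsub>Y\<^esub> y) else 0)"

definition normed_space :: "('k::real_or_complex, 'a) tvs \<Rightarrow> bool" where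
  "normed_space Y \<longleftrightarrow> vector_space_on Y \<and> (\<exists>N. norm_on Y N \<and> topo Y = norm_topology Y N)"

definition l1_norm :: "(nat \<Rightarrow> 'k::real_or_complex) \<Rightarrow> real" where
  "l1_norm x = (\<Sum>n. norm (x n))"

text \<open>The inner record only supplies the algebraic structure needed by \<open>norm_topology\<close>.\<close>

definition l1 :: "('k::real_or_complex, nat \<Rightarrow> 'k) tvs" where
  "l1 = (let V = \<lparr>carrier = {x. summable (\<lambda>n. norm (x n))}, mult = undefined, one = undefined,
                   zero = (\<lambda>n. 0), add = (\<lambda>x y n. x n + y n), smult = (\<lambda>c x n. c * x n),
                   topo = undefined\<rparr>
         in V\<lparr>topo := norm_topology V l1_norm\<rparr>)"

definition linear_span_in :: "('k::real_or_complex, 'a) tvs \<Rightarrow> 'a set \<Rightarrow> 'a set" where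
  "linear_span_in E A = \<Inter>{H. submodule H (scalar_space :: ('k, 'k) tvs) E \<and> A \<subseteq> H}"

definition unit_vector :: "nat \<Rightarrow> nat \<Rightarrow> 'k::real_or_complex" where
  "unit_vector k = (\<lambda>n. if n = k then 1 else 0)"

definition l1_0 :: "('k::real_or_complex, nat \<Rightarrow> 'k) tvs" where
  "l1_0 = (let V = l1\<lparr>carrier := linear_span_in l1 (range unit_vector)\<rparr>
           in V\<lparr>topo := norm_topology V l1_norm\<rparr>)"


section \<open>The operator conditions\<close>

text \<open>
  \<open>C\<close> is one of \<^const>\<open>weakly_seq_precompact_operator\<close> and \<^const>\<open>weakly_seq_compact_operator\<close>.
\<close>

definition adjoint_p_convergent_implies ::
  "ereal \<Rightarrow> (('k::real_or_complex, 'y) tvs \<Rightarrow> ('k, 'a) tvs \<Rightarrow> ('y \<Rightarrow> 'a) \<Rightarrow> bool) \<Rightarrow>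
     ('k, 'y) tvs \<Rightarrow> ('k, 'a) tvs \<Rightarrow> bool" where
  "adjoint_p_convergent_implies p C Y E \<longleftrightarrow>
     (\<forall>T. operator Y E T \<and> p_convergent p (strong_dual E) (strong_dual Y) (adjoint_map Y T) \<longrightarrow>
        C Y E T)"

end

theory Submission
  imports Defs
begin

text \<open>
Everything turns on a dictionary between operators from normed spaces and p-V* sets.

If \<open>T : Y \<rightarrow> E\<close> is an operator from a normed space with unit ball \<open>B\<close>, then the value of the
seminorm \<open>sup {norm (f b) | b. b \<in> B}\<close> of the strong dual of \<open>Y\<close> at the adjoint image of a functional
\<open>\<phi>\<close> is the supremum of \<open>norm \<phi>\<close> over \<open>T ` B\<close>. So the adjoint of \<open>T\<close> is p-convergent exactly if
\<open>T ` B\<close> is a p-V* set, and a property of all p-V* sets yields the corresponding property of \<open>T\<close>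
(\<open>p_Vstar_set_image_ball\<close>). This gives (iii) \<open>\<Longrightarrow>\<close> (i), and (ii) and (iv) are instances of (i).

Conversely, let \<open>x\<close> be a sequence in a p-V* set \<open>A\<close>. The operator \<open>T c = (\<Sum>n. c n \<odot> x n)\<close> on a space of
absolutely summable sequences sends the unit vectors to the \<open>x n\<close>. Its unit ball has its image in
the closed absolutely convex hull of \<open>A\<close>, so that \<open>norm (\<phi> (T c)) \<le> l1_norm c * sup {norm (\<phi> a) | a. a \<in> A}\<close>
and the adjoint of \<open>T\<close> is p-convergent. The hypothesis on \<open>T\<close> now says that the image of a
neighbourhood of zero is weakly sequentially precompact (or relatively weakly sequentially
compact); that image contains the sequence \<open>c \<odot> x n\<close> for some scalar \<open>c \<noteq> 0\<close>, and dividing by \<open>c\<close> gives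
the desired subsequence of \<open>x\<close> (\<open>operator_through_p_Vstar_sequence\<close>).

Two points need work. First, \<open>T\<close> has to be continuous for the original topology of \<open>E\<close>, which
requires \<open>A\<close> to be bounded. Testing \<open>A\<close> against the weakly p-summable sequences \<open>(1/2) ^ n \<cdot> \<phi>\<close>
shows only that \<open>A\<close> is weakly bounded; that weakly bounded sets are bounded is Mackey's theorem
(\<open>seminorm_bounded_if_weakly_bounded\<close>), proved by a gliding hump from a Hahn-Banach theorem
(\<open>linear_functional_with_large_value\<close>). Second, the series has to converge. On finitely supported
sequences it is a finite sum. On all of \<open>l1\<close>, local completeness is used in the form that a sequence
whose increments are dominated, in each continuous seminorm, by a multiple of one summable
sequence converges (\<open>locally_complete_convergent\<close>).

In (i) the normed spaces live on the type \<open>'y\<close>, which may differ from \<open>nat \<Rightarrow> 'k\<close>. The sequence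
spaces are therefore built along an injection into the carrier type: the identity gives
\<open>l1_0\<close> and \<open>l1\<close>, an injection into \<open>'y\<close> gives the copy of \<open>l1_0\<close> that the hypothesis of (i) is applied to.
\<close>
section \<open>The scalar field\<close>

lemma convergent_if_isometric_to_banach:
  fixes h :: "'a::real_normed_vector \<Rightarrow> 'b::banach"
  assumes bij: "bij h" and add: "\<And>x y. h (x + y) = h x + h y" and norm: "\<And>x. norm (h x) = norm x"
    and X: "Cauchy (X :: nat \<Rightarrow> 'a)"
  shows "convergent X"
proof -
  have minus: "h (x - y) = h x - h y" for x y
    using add[of "x - y" y] by simp
  have "Cauchy (\<lambda>n. h (X n))"
    using X by (simp add: Cauchy_def dist_norm norm flip: minus)
  then obtain l where l: "(\<lambda>n. h (X n)) \<longlonglongrightarrow> l"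
    using Cauchy_convergent convergentD by blast
  obtain k where k: "h k = l" using bij by (metis bij_pointE)
  have "X \<longlonglongrightarrow> k"
    using l by (simp add: lim_sequentially dist_norm norm flip: minus k)
  then show ?thesis by (rule convergentI)
qed

text \<open>
Series of scalars are summed when functionals are glued together, hence the scalars must be complete.
\<close>

instance real_or_complex \<subseteq> banach
proof
  fix X :: "nat \<Rightarrow> 'a" assume X: "Cauchy X"
  show "convergent X"
    using isometric_to_real_or_complex[where 'a='a]
  proof (elim disjE exE conjE)
    fix h :: "'a \<Rightarrow> real"
    assume "bij h" "\<forall>x y. h (x + y) = h x + h y" "\<forall>x. norm (h x) = norm x"
    then show ?thesis using convergent_if_isometric_to_banach[of h X] X by simp
  next
    fix h :: "'a \<Rightarrow> complex"
    assume "bij h" "\<forall>x y. h (x + y) = h x + h y" "\<forall>x. norm (h x) = norm x"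
    then show ?thesis using convergent_if_isometric_to_banach[of h X] X by simp
  qed
qed

text \<open>
An additive map that preserves 1 fixes the rationals; being isometric, it is continuous, so it
fixes all reals.
\<close>

lemma isometric_ring_iso_of_real:
  fixes h :: "'k::real_or_complex \<Rightarrow> 'b::real_normed_field"
  assumes bij: "bij h" and add: "\<And>x y. h (x + y) = h x + h y"
    and mult: "\<And>x y. h (x * y) = h x * h y" and norm: "\<And>x. norm (h x) = norm x"
  shows "h (of_real r) = of_real r"
proof -
  interpret additive h by unfold_locales (rule add)
  have "h 1 \<noteq> 0" using norm[of 1] by auto
  then have "h 1 = 1" using mult[of 1 1] by simp
  have nat: "h (of_nat n) = of_nat n" for n
    by (induction n) (simp_all add: add zero \<open>h 1 = 1\<close>)
  have int: "h (of_int n) = of_int n" for n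
    by (cases n) (simp_all add: nat minus add diff \<open>h 1 = 1\<close>)
  have rat: "h (of_real q) = of_real q" if q: "q \<in> \<rat>" for q
  proof -
    obtain a b :: int where ab: "b \<noteq> 0" "q = of_int a / of_int b"
      using q by (metis Rats_cases' less_numeral_extra(3))
    have "of_real q * of_int b = (of_int a :: 'k)" using ab by simp
    then have "h (of_real q) * of_int b = of_int a" by (metis int mult)
    then have "h (of_real q) = of_int a / of_int b"
      using ab(1) by (simp add: nonzero_eq_divide_eq)
    then show ?thesis using ab(2) by simp
  qed
  have "norm (h (of_real r) - of_real r) \<le> e" if "e > 0" for e :: real
  proof -
    obtain q where q: "q \<in> \<rat>" "r < q" "q < r + e/2"
      using Rats_dense_in_real[of r "r + e/2"] \<open>e > 0\<close> by auto
    have eq: "h (of_real r) - of_real r = h (of_real (r - q)) + of_real (q - r)"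
      using rat[OF q(1)] by (simp add: diff)
    have "norm (h (of_real (r - q))) + norm (of_real (q - r) :: 'b) \<le> e"
      using q by (simp add: norm del: of_real_diff)
    then show ?thesis unfolding eq by (rule norm_triangle_le)
  qed
  then show ?thesis by (metis field_le_epsilon add_0 norm_le_zero_iff right_minus_eq)
qed

text \<open>
This replaces the abstract scalar type by its two concrete forms in the only place where they
differ, the passage from real-linear to \<open>'k\<close>-linear functionals.
\<close>

lemma real_or_complex_cases:
  obtains (real) "\<And>k :: 'k::real_or_complex. \<exists>a. k = of_real a"
  | (complex) \<iota> :: "'k::real_or_complex" where "\<iota> * \<iota> = - 1" "norm \<iota> = 1"
      "\<And>k. \<exists>a b. k = of_real a + of_real b * \<iota>"
      "\<And>a b. \<bar>a\<bar> \<le> norm (of_real a + of_real b * \<iota>)"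
  using isometric_to_real_or_complex[where 'a='k]
proof (elim disjE exE conjE)
  fix h :: "'k \<Rightarrow> real"
  assume h: "bij h" "\<forall>x y. h (x + y) = h x + h y" "\<forall>x y. h (x * y) = h x * h y"
    "\<forall>x. norm (h x) = norm x"
  have "h (of_real (h k)) = h k" for k
    using isometric_ring_iso_of_real[of h] h by simp
  then have "k = of_real (h k)" for k using h(1) by (metis bij_pointE)
  then show ?thesis using real by blast
next
  fix h :: "'k \<Rightarrow> complex"
  assume h: "bij h" "\<forall>x y. h (x + y) = h x + h y" "\<forall>x y. h (x * y) = h x * h y"
    "\<forall>x. norm (h x) = norm x"
  have re: "h (of_real r) = of_real r" for r
    using isometric_ring_iso_of_real[of h] h by simp
  obtain \<iota> where i: "h \<iota> = \<i>" using h(1) by (metis bij_pointE)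
  have inj: "h x = h y \<Longrightarrow> x = y" for x y using h(1) by (metis bij_pointE)
  have comb: "h (of_real a + of_real b * \<iota>) = Complex a b" for a b
    using h re by (simp add: i complex_eq_iff)
  show ?thesis
  proof (rule complex)
    have "h (\<iota> * \<iota>) = h (of_real (- 1))" unfolding re using h by (simp add: i)
    then show "\<iota> * \<iota> = - 1" using inj by fastforce
    show "norm \<iota> = 1" using h i by (metis norm_ii)
    show "\<exists>a b. k = of_real a + of_real b * \<iota>" for k
      by (rule exI[of _ "Re (h k)"], rule exI[of _ "Im (h k)"], rule inj) (simp add: comb)
    show "\<bar>a\<bar> \<le> norm (of_real a + of_real b * \<iota>)" for a b
      using abs_Re_le_cmod[of "Complex a b"] h comb by (metis complex.sel(1))
  qed
qed

section \<open>Vector spaces and seminorms\<close>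

lemma scalar_space_simps [simp]:
  "carrier scalar_space = UNIV" "x \<oplus>\<^bsub>scalar_space\<^esub> y = x + y" "x \<otimes>\<^bsub>scalar_space\<^esub> y = x * y"
  "\<zero>\<^bsub>scalar_space\<^esub> = 0" "\<one>\<^bsub>scalar_space\<^esub> = 1" "x \<odot>\<^bsub>scalar_space\<^esub> y = x * y"
  "topo scalar_space = euclidean"
  by (simp_all add: scalar_space_def)

lemma cring_scalar_space: "cring (scalar_space :: ('k::real_or_complex, 'k) tvs)"
proof (rule cringI)
  show "abelian_group (scalar_space :: ('k, 'k) tvs)"
    by (rule abelian_groupI) (auto simp: algebra_simps intro: exI[of _ "- x" for x])
  show "Group.comm_monoid (scalar_space :: ('k, 'k) tvs)"
    by unfold_locales (auto simp: algebra_simps)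
qed (simp add: algebra_simps)

locale vec =
  fixes E :: "('k::real_or_complex, 'a) tvs" (structure)
  assumes vec: "vector_space_on E"
begin

sublocale M: module "scalar_space :: ('k, 'k) tvs" E
  using vec by (simp add: vector_space_on_def)

lemma closed [simp, intro]:
  "x \<in> carrier E \<Longrightarrow> y \<in> carrier E \<Longrightarrow> x \<oplus> y \<in> carrier E"
  "x \<in> carrier E \<Longrightarrow> y \<in> carrier E \<Longrightarrow> x \<ominus> y \<in> carrier E"
  "x \<in> carrier E \<Longrightarrow> \<ominus> x \<in> carrier E"
  "x \<in> carrier E \<Longrightarrow> c \<odot> x \<in> carrier E"
  "\<zero> \<in> carrier E"
  using M.smult_closed by simp_all

lemma smult_simps [simp]:
  assumes "x \<in> carrier E"
  shows "1 \<odot> x = x" "0 \<odot> x = \<zero>" "c \<odot> \<zero> = \<zero>" "c \<odot> (d \<odot> x) = (c * d) \<odot> x"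
  using M.smult_one[of x] M.smult_l_null[of x] M.smult_r_null[of c] M.smult_assoc1[of c d x] assms
  by simp_all

lemma smult_add_left: "x \<in> carrier E \<Longrightarrow> (c + d) \<odot> x = c \<odot> x \<oplus> d \<odot> x"
  using M.smult_l_distr[of c d x] by simp

lemma smult_add_right:
  "x \<in> carrier E \<Longrightarrow> y \<in> carrier E \<Longrightarrow> c \<odot> (x \<oplus> y) = c \<odot> x \<oplus> c \<odot> y"
  using M.smult_r_distr[of c x y] by simp

lemma uminus_eq: "x \<in> carrier E \<Longrightarrow> \<ominus> x = (-1) \<odot> x"
  using smult_add_left[of x 1 "-1"] M.M.minus_equality[of "(-1) \<odot> x" x] M.M.a_comm by simp

lemma minus_eq: "x \<in> carrier E \<Longrightarrow> y \<in> carrier E \<Longrightarrow> x \<ominus> y = x \<oplus> (-1) \<odot> y"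
  by (simp add: a_minus_def uminus_eq)

lemma add_diff_cancel [simp]:
  "x \<in> carrier E \<Longrightarrow> y \<in> carrier E \<Longrightarrow> (x \<ominus> y) \<oplus> y = x"
  "x \<in> carrier E \<Longrightarrow> y \<in> carrier E \<Longrightarrow> (x \<oplus> y) \<ominus> y = x"
  by (simp_all add: a_minus_def M.M.a_assoc M.M.l_neg M.M.r_neg)

lemma diff_self [simp]: "x \<in> carrier E \<Longrightarrow> x \<ominus> x = \<zero>"
  by (simp add: a_minus_def M.M.r_neg)

lemma diff_zero [simp]: "x \<in> carrier E \<Longrightarrow> x \<ominus> \<zero> = x"
  by (simp add: minus_eq)

lemma smult_diff_right:
  "x \<in> carrier E \<Longrightarrow> y \<in> carrier E \<Longrightarrow> c \<odot> (x \<ominus> y) = c \<odot> x \<ominus> c \<odot> y"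
  by (simp add: minus_eq smult_add_right mult.commute)

lemma add_add_swap:
  "\<lbrakk>a \<in> carrier E; b \<in> carrier E; c \<in> carrier E; d \<in> carrier E\<rbrakk> \<Longrightarrow>
    (a \<oplus> b) \<oplus> (c \<oplus> d) = (a \<oplus> c) \<oplus> (b \<oplus> d)"
  by (simp add: M.M.a_ac)

lemma diff_add_diff:
  "\<lbrakk>a \<in> carrier E; b \<in> carrier E; c \<in> carrier E\<rbrakk> \<Longrightarrow> (a \<ominus> b) \<oplus> (b \<ominus> c) = a \<ominus> c"
  by (metis M.M.a_assoc a_minus_def add_diff_cancel(1) closed(2) closed(3))

lemma add_diff_add:
  "\<lbrakk>a \<in> carrier E; b \<in> carrier E; c \<in> carrier E; d \<in> carrier E\<rbrakk> \<Longrightarrow>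
    (a \<oplus> b) \<ominus> (c \<oplus> d) = (a \<ominus> c) \<oplus> (b \<ominus> d)"
  by (simp add: minus_eq smult_add_right add_add_swap)

definition seminorm :: "('a \<Rightarrow> real) \<Rightarrow> bool" where
  "seminorm q \<longleftrightarrow> (\<forall>x\<in>carrier E. \<forall>y\<in>carrier E. q (x \<oplus> y) \<le> q x + q y) \<and>
     (\<forall>c. \<forall>x\<in>carrier E. q (c \<odot> x) = norm c * q x)"

lemma seminorm_add: "seminorm q \<Longrightarrow> x \<in> carrier E \<Longrightarrow> y \<in> carrier E \<Longrightarrow> q (x \<oplus> y) \<le> q x + q y"
  by (simp add: seminorm_def)

lemma seminorm_smult: "seminorm q \<Longrightarrow> x \<in> carrier E \<Longrightarrow> q (c \<odot> x) = norm c * q x"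
  by (simp add: seminorm_def)

lemma seminorm_zero: "seminorm q \<Longrightarrow> q \<zero> = 0"
  using seminorm_smult[of q \<zero> 0] by simp

lemma seminorm_nonneg: 
  assumes "seminorm q" "x \<in> carrier E" shows "0 \<le> q x"
proof -
  have "x \<oplus> (-1) \<odot> x = \<zero>"
    using assms(2) by (metis diff_self minus_eq)
  then show ?thesis
    using seminorm_add[of q x "(-1) \<odot> x"] seminorm_smult[of q x "-1"]
      seminorm_zero[of q] assms by simp
qed

lemma seminorm_diff: "seminorm q \<Longrightarrow> x \<in> carrier E \<Longrightarrow> y \<in> carrier E \<Longrightarrow> q (x \<ominus> y) \<le> q x + q y"
  using seminorm_add[of q x "(-1) \<odot> y"] by (simp add: minus_eq seminorm_smult)

lemma seminorm_diff_commute: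
  assumes "seminorm q" "x \<in> carrier E" "y \<in> carrier E" shows "q (x \<ominus> y) = q (y \<ominus> x)"
proof -
  have "y \<ominus> x = (-1) \<odot> (x \<ominus> y)"
    using assms by (simp add: minus_eq smult_add_right M.M.a_comm)
  then show ?thesis using assms seminorm_smult[of q "x \<ominus> y" "-1"] by simp
qed

lemma seminorm_diff_triangle:
  "\<lbrakk>seminorm q; a \<in> carrier E; b \<in> carrier E; c \<in> carrier E\<rbrakk> \<Longrightarrow>
    q (a \<ominus> c) \<le> q (a \<ominus> b) + q (b \<ominus> c)"
  by (metis closed(2) diff_add_diff seminorm_add)

end

section \<open>Continuous seminorms\<close>

locale lcs = vec E for E :: "('k::real_or_complex, 'a) tvs" (structure) +
  assumes lc: "locally_convex_space E"

lemma lcsI: "locally_convex_space E \<Longrightarrow> lcs E"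
  by (simp add: lcs_def vec_def lcs_axioms_def locally_convex_space_def)

context lcs
begin

lemma topspace_topo [simp]: "topspace (topo E) = carrier E"
  using lc by (simp add: locally_convex_space_def)

lemma continuous_map_add:
  assumes "continuous_map X (topo E) f" "continuous_map X (topo E) g"
  shows "continuous_map X (topo E) (\<lambda>x. f x \<oplus> g x)"
proof -
  have "continuous_map (prod_topology (topo E) (topo E)) (topo E) (\<lambda>(x, y). x \<oplus> y)"
    using lc by (simp add: locally_convex_space_def)
  from continuous_map_compose[OF continuous_map_pairedI[OF assms] this] show ?thesis
    by (simp add: o_def)
qed

lemma continuous_map_smult:
  assumes "continuous_map X euclidean c" "continuous_map X (topo E) f"
  shows "continuous_map X (topo E) (\<lambda>x. c x \<odot> f x)"
proof -
  have "continuous_map (prod_topology euclidean (topo E)) (topo E) (\<lambda>(c, x). c \<odot> x)"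
    using lc by (simp add: locally_convex_space_def)
  from continuous_map_compose[OF continuous_map_pairedI[OF assms] this] show ?thesis
    by (simp add: o_def)
qed

lemma openin_affine_preimage:
  assumes "openin (topo E) U" "b \<in> carrier E"
  shows "openin (topo E) {x \<in> carrier E. c \<odot> (x \<oplus> b) \<in> U}"
proof -
  have "continuous_map (topo E) (topo E) (\<lambda>x. c \<odot> (x \<oplus> b))"
    using assms(2) by (intro continuous_map_smult continuous_map_add) auto
  from openin_continuous_map_preimage[OF this assms(1)] show ?thesis by simp
qed

text \<open>A seminorm is continuous as soon as it is bounded by 1 near zero.\<close>

definition cont_seminorm :: "('a \<Rightarrow> real) \<Rightarrow> bool" where
  "cont_seminorm q \<longleftrightarrow> seminorm q \<and>
     (\<exists>V. openin (topo E) V \<and> \<zero> \<in> V \<and> (\<forall>x\<in>V. q x < 1))"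

lemma cont_seminorm_ball:
  assumes q: "cont_seminorm q" and a: "a \<in> carrier E" and r: "0 < r"
  obtains V where "openin (topo E) V" "a \<in> V" "\<And>x. x \<in> V \<Longrightarrow> q (x \<ominus> a) < r"
proof -
  obtain U where U: "openin (topo E) U" "\<zero> \<in> U" "\<And>x. x \<in> U \<Longrightarrow> q x < 1"
    using q by (auto simp: cont_seminorm_def)
  let ?V = "{x \<in> carrier E. of_real (1/r) \<odot> (x \<oplus> (-1) \<odot> a) \<in> U}"
  show ?thesis
  proof (rule that[of ?V])
    show "openin (topo E) ?V" using U(1) a by (intro openin_affine_preimage) auto
    show "a \<in> ?V" using a U(2) by (simp add: minus_eq[symmetric])
    fix x assume x: "x \<in> ?V"
    then have "q (of_real (1/r) \<odot> (x \<ominus> a)) < 1"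
      using U(3) a by (simp add: minus_eq)
    then show "q (x \<ominus> a) < r"
      using q a x r by (simp add: cont_seminorm_def seminorm_smult norm_divide)
  qed
qed

text \<open>
The points \<open>x\<close> all of whose multiples \<open>c \<odot> x\<close> with \<open>norm c \<le> 1\<close> lie in a convex neighbourhood form a
convex and balanced set. It is again a neighbourhood because scalar multiplication is jointly
continuous at \<open>(0, \<zero>)\<close>.
\<close>

lemma balanced_convex_nbhd:
  assumes "openin (topo E) U" "\<zero> \<in> U"
  obtains W V where "W \<subseteq> U" "W \<subseteq> carrier E" "openin (topo E) V" "\<zero> \<in> V" "V \<subseteq> W"
    "\<And>x c. x \<in> W \<Longrightarrow> norm c \<le> 1 \<Longrightarrow> c \<odot> x \<in> W"
    "\<And>x y t. x \<in> W \<Longrightarrow> y \<in> W \<Longrightarrow> 0 \<le> t \<Longrightarrow> t \<le> 1 \<Longrightarrow>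
        of_real (1 - t) \<odot> x \<oplus> of_real t \<odot> y \<in> W"
proof -
  obtain C where C: "openin (topo E) C" "\<zero> \<in> C" "C \<subseteq> U" "convex_in E C"
    using lc assms unfolding locally_convex_space_def by blast
  define W where "W = {x \<in> carrier E. \<forall>c. norm c \<le> 1 \<longrightarrow> c \<odot> x \<in> C}"
  define P where "P = {z \<in> UNIV \<times> carrier E. (\<lambda>(c, x). c \<odot> x) z \<in> C}"
  have "continuous_map (prod_topology euclidean (topo E)) (topo E) (\<lambda>(c, x). c \<odot> x)"
    using lc by (simp add: locally_convex_space_def)
  from openin_continuous_map_preimage[OF this C(1)]
  have P: "openin (prod_topology euclidean (topo E)) P" by (simp add: P_def)
  have "(0, \<zero>) \<in> P" using C(2) by (simp add: P_def)
  then have "\<exists>G H. openin euclidean G \<and> openin (topo E) H \<and> 0 \<in> G \<and> \<zero> \<in> H \<and> G \<times> H \<subseteq> P"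
    using P unfolding openin_prod_topology_alt by blast
  then obtain G H where GH: "open G" "openin (topo E) H" "0 \<in> G" "\<zero> \<in> H" "G \<times> H \<subseteq> P"
    by auto
  then obtain \<delta> where \<delta>: "\<delta> > 0" "ball 0 \<delta> \<subseteq> G"
    using open_contains_ball by blast
  let ?V = "{x \<in> carrier E. of_real (2/\<delta>) \<odot> (x \<oplus> \<zero>) \<in> H}"
  show ?thesis
  proof (rule that[of W ?V])
    show "W \<subseteq> U"
    proof
      fix x assume "x \<in> W"
      then have "x \<in> carrier E" "1 \<odot> x \<in> C" by (auto simp: W_def dest: spec[of _ 1])
      then show "x \<in> U" using C(3) by auto
    qed
    show "W \<subseteq> carrier E" by (auto simp: W_def)
    show "openin (topo E) ?V" using GH(2) by (intro openin_affine_preimage) auto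
    show "\<zero> \<in> ?V" using GH(4) by simp
    show "?V \<subseteq> W"
    proof
      fix x assume "x \<in> ?V"
      then have x: "x \<in> carrier E" "of_real (2/\<delta>) \<odot> x \<in> H" by auto
      have "c \<odot> x \<in> C" if c: "norm c \<le> 1" for c
      proof -
        have "norm (c * of_real (\<delta>/2)) \<le> 1 * (\<delta>/2)"
          unfolding norm_mult using c \<delta>(1) by (intro mult_mono) (auto simp: norm_divide)
        also have "\<dots> < \<delta>" using \<delta>(1) by simp
        finally have "c * of_real (\<delta>/2) \<in> G" using \<delta>(2) by auto
        then have "(c * of_real (\<delta>/2), of_real (2/\<delta>) \<odot> x) \<in> P" using x GH(5) by blast
        then show ?thesis using x \<delta>(1) by (simp add: P_def)
      qed
      then show "x \<in> W" using x by (simp add: W_def)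
    qed
    show "c \<odot> x \<in> W" if "x \<in> W" "norm c \<le> 1" for x c
      using that by (auto simp: W_def norm_mult mult_le_one)
    show "of_real (1 - t) \<odot> x \<oplus> of_real t \<odot> y \<in> W"
      if "x \<in> W" "y \<in> W" "0 \<le> t" "t \<le> 1" for x y t
    proof -
      have car: "x \<in> carrier E" "y \<in> carrier E" using that by (auto simp: W_def)
      have "c \<odot> (of_real (1 - t) \<odot> x \<oplus> of_real t \<odot> y) \<in> C" if c: "norm c \<le> 1" for c
      proof -
        have "c \<odot> x \<in> C" "c \<odot> y \<in> C" using \<open>x \<in> W\<close> \<open>y \<in> W\<close> c by (auto simp: W_def)
        then have "of_real (1 - t) \<odot> (c \<odot> x) \<oplus> of_real t \<odot> (c \<odot> y) \<in> C"
          using C(4) \<open>0 \<le> t\<close> \<open>t \<le> 1\<close> unfolding convex_in_def by blast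
        then show ?thesis using car by (simp add: smult_add_right mult.commute)
      qed
      then show ?thesis using car by (simp add: W_def)
    qed
  qed
qed

text \<open>
The seminorm is the Minkowski functional of a balanced convex neighbourhood inside \<open>U\<close>.
\<close>

lemma exists_cont_seminorm:
  assumes "openin (topo E) U" "\<zero> \<in> U"
  obtains q where "cont_seminorm q" "\<And>x. x \<in> carrier E \<Longrightarrow> q x < 1 \<Longrightarrow> x \<in> U"
proof -
  obtain W V where W: "W \<subseteq> U" "W \<subseteq> carrier E" "openin (topo E) V" "\<zero> \<in> V" "V \<subseteq> W"
    and bal: "\<And>x c. x \<in> W \<Longrightarrow> norm c \<le> 1 \<Longrightarrow> c \<odot> x \<in> W"
    and conv: "\<And>x y t. x \<in> W \<Longrightarrow> y \<in> W \<Longrightarrow> 0 \<le> t \<Longrightarrow> t \<le> 1 \<Longrightarrow>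
        of_real (1 - t) \<odot> x \<oplus> of_real t \<odot> y \<in> W"
    using balanced_convex_nbhd[OF assms] by blast
  \<comment> \<open>the \<open>t > 0\<close> with \<open>x \<in> t \<odot> W\<close>; their infimum is the Minkowski functional of \<open>W\<close>\<close>
  define S where "S x = {t::real. 0 < t \<and> of_real (1/t) \<odot> x \<in> W}" for x
  define q where "q x = Inf (S x)" for x
  have ne: "S x \<noteq> {}" if x: "x \<in> carrier E" for x
  proof -
    have "continuous_map euclidean (topo E) (\<lambda>c. c \<odot> x)"
      using x by (intro continuous_map_smult) auto
    from openin_continuous_map_preimage[OF this W(3)] have "open {c. c \<odot> x \<in> V}" by simp
    moreover have "0 \<in> {c. c \<odot> x \<in> V}" using x W(4) by simp
    ultimately obtain \<delta> where \<delta>: "\<delta> > 0" "ball 0 \<delta> \<subseteq> {c. c \<odot> x \<in> V}"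
      using open_contains_ball by blast
    have "of_real (\<delta>/2) \<in> ball (0::'k) \<delta>" using \<delta>(1) by (simp add: norm_divide)
    then have "of_real (\<delta>/2) \<odot> x \<in> W" using \<delta>(2) W(5) by blast
    then have "2/\<delta> \<in> S x" using \<delta>(1) by (simp add: S_def)
    then show ?thesis by blast
  qed
  have bdd: "bdd_below (S x)" for x by (rule bdd_belowI[of _ 0]) (simp add: S_def)
  have lower: "q x \<le> t" if "t \<in> S x" for x t
    unfolding q_def using that bdd by (rule cInf_lower)
  have greatest: "r \<le> q x" if "x \<in> carrier E" "\<And>t. t \<in> S x \<Longrightarrow> r \<le> t" for r x
    unfolding q_def using that ne by (intro cInf_greatest) auto
  have smult_le: "q (c \<odot> x) \<le> norm c * q x" if x: "x \<in> carrier E" and c: "c \<noteq> 0" for c x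
  proof -
    have "q (c \<odot> x) / norm c \<le> q x"
    proof (rule greatest[OF x])
      fix t assume t: "t \<in> S x"
      have "(c / of_real (norm c)) \<odot> (of_real (1/t) \<odot> x) \<in> W"
        using t c by (intro bal[of "of_real (1/t) \<odot> x"]) (simp_all add: S_def norm_divide)
      then have "norm c * t \<in> S (c \<odot> x)"
        using t c x by (simp add: S_def mult.commute)
      then show "q (c \<odot> x) / norm c \<le> t" using lower c by (simp add: divide_le_eq mult.commute)
    qed
    then show ?thesis using c by (simp add: divide_le_eq mult.commute)
  qed
  have zero: "q \<zero> = 0"
  proof (rule antisym)
    show "q \<zero> \<le> 0"
    proof (rule field_le_epsilon)
      fix e :: real assume "0 < e"
      then have "e \<in> S \<zero>" using W(4,5) by (auto simp: S_def)
      then show "q \<zero> \<le> 0 + e" using lower by simp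
    qed
    show "0 \<le> q \<zero>" by (rule greatest) (auto simp: S_def)
  qed
  have "seminorm q"
    unfolding seminorm_def
  proof (intro conjI ballI allI)
    fix c x assume x: "x \<in> carrier E"
    show "q (c \<odot> x) = norm c * q x"
    proof (cases "c = 0")
      case False
      have "q x \<le> q (c \<odot> x) / norm c"
        using smult_le[of "c \<odot> x" "inverse c"] x False
        by (simp add: nonzero_norm_inverse divide_inverse mult.commute)
      then show ?thesis using smult_le[OF x False] False by (simp add: field_simps)
    qed (simp add: zero x)
  next
    fix x y assume x: "x \<in> carrier E" and y: "y \<in> carrier E"
    \<comment> \<open>\<open>(x + y) / (s + t)\<close> is a convex combination of \<open>x / s\<close> and \<open>y / t\<close>\<close>
    have st: "q (x \<oplus> y) \<le> s + t" if s: "s \<in> S x" and t: "t \<in> S y" for s t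
    proof -
      have pos: "s > 0" "t > 0" using s t by (auto simp: S_def)
      have "of_real (1 - t/(s+t)) \<odot> (of_real (1/s) \<odot> x) \<oplus> of_real (t/(s+t)) \<odot> (of_real (1/t) \<odot> y) \<in> W"
        using s t pos by (intro conv[of "of_real (1/s) \<odot> x" "of_real (1/t) \<odot> y"]) (simp_all add: S_def)
      moreover have "of_real (1 - t/(s+t)) \<odot> (of_real (1/s) \<odot> x) = of_real (1/(s+t)) \<odot> x"
      proof -
        have "(1 - t/(s+t)) * (1/s) = 1/(s+t)" using pos by (simp add: field_simps)
        then show ?thesis unfolding smult_simps(4)[OF x] of_real_mult[symmetric] by (rule ssubst) (rule refl)
      qed
      moreover have "of_real (t/(s+t)) \<odot> (of_real (1/t) \<odot> y) = of_real (1/(s+t)) \<odot> y"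
      proof -
        have "(t/(s+t)) * (1/t) = 1/(s+t)" using pos by (simp add: field_simps)
        then show ?thesis unfolding smult_simps(4)[OF y] of_real_mult[symmetric] by (rule ssubst) (rule refl)
      qed
      ultimately have "of_real (1/(s+t)) \<odot> x \<oplus> of_real (1/(s+t)) \<odot> y \<in> W"
        by simp
      then have "s + t \<in> S (x \<oplus> y)" using pos x y by (simp add: S_def smult_add_right)
      then show ?thesis by (rule lower)
    qed
    have "q (x \<oplus> y) - s \<le> q y" if "s \<in> S x" for s
      by (rule greatest[OF y]) (use st[OF that] in \<open>simp add: algebra_simps\<close>)
    then have "q (x \<oplus> y) - q y \<le> q x"
      by (intro greatest[OF x]) (simp add: algebra_simps)
    then show "q (x \<oplus> y) \<le> q x + q y" by simp
  qed
  moreover have "openin (topo E) {x \<in> carrier E. 2 \<odot> (x \<oplus> \<zero>) \<in> V}"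
    using W(3) by (intro openin_affine_preimage) auto
  moreover have "q x < 1" if "x \<in> carrier E" "2 \<odot> (x \<oplus> \<zero>) \<in> V" for x
  proof -
    have "1/2 \<in> S x" using that W(5) by (auto simp: S_def)
    then show ?thesis using lower[of "1/2" x] by simp
  qed
  ultimately have "cont_seminorm q"
    unfolding cont_seminorm_def using W(4)
    by (intro conjI exI[of _ "{x \<in> carrier E. 2 \<odot> (x \<oplus> \<zero>) \<in> V}"]) auto
  moreover have "x \<in> U" if x: "x \<in> carrier E" "q x < 1" for x
  proof -
    obtain t where t: "t \<in> S x" "t < 1"
      using x(2) cInf_less_iff[OF ne[OF x(1)] bdd, of 1] unfolding q_def by blast
    then have "of_real t \<odot> (of_real (1/t) \<odot> x) \<in> W"
      by (intro bal[of "of_real (1/t) \<odot> x"]) (simp_all add: S_def)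
    moreover have "of_real t \<odot> (of_real (1/t) \<odot> x) = x" using x t by (simp add: S_def)
    ultimately show ?thesis using W(1) by auto
  qed
  ultimately show ?thesis by (rule that)
qed

lemma cont_seminorm_ball_in_open:
  assumes U: "openin (topo E) U" "a \<in> U"
  obtains q where "cont_seminorm q" "\<And>x. x \<in> carrier E \<Longrightarrow> q (x \<ominus> a) < 1 \<Longrightarrow> x \<in> U"
proof -
  have a: "a \<in> carrier E" using U openin_subset by fastforce
  have "openin (topo E) {x \<in> carrier E. 1 \<odot> (x \<oplus> a) \<in> U}"
    using U a by (intro openin_affine_preimage) auto
  moreover have "\<zero> \<in> {x \<in> carrier E. 1 \<odot> (x \<oplus> a) \<in> U}" using a U by simp
  ultimately obtain q where q: "cont_seminorm q"
    "\<And>x. x \<in> carrier E \<Longrightarrow> q x < 1 \<Longrightarrow> x \<in> {x \<in> carrier E. 1 \<odot> (x \<oplus> a) \<in> U}"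
    using exists_cont_seminorm by blast
  show ?thesis
  proof (rule that[OF q(1)])
    fix x assume "x \<in> carrier E" "q (x \<ominus> a) < 1"
    then show "x \<in> U" using q(2)[of "x \<ominus> a"] a by simp
  qed
qed

lemma limitin_iff_seminorms:
  assumes "range s \<subseteq> carrier E"
  shows "limitin (topo E) s l sequentially \<longleftrightarrow>
    l \<in> carrier E \<and> (\<forall>q. cont_seminorm q \<longrightarrow> (\<lambda>n. q (s n \<ominus> l)) \<longlonglongrightarrow> 0)"
proof (safe)
  assume lim: "limitin (topo E) s l sequentially"
  then show l: "l \<in> carrier E" by (simp add: limitin_def)
  fix q assume q: "cont_seminorm q"
  show "(\<lambda>n. q (s n \<ominus> l)) \<longlonglongrightarrow> 0"
  proof (rule tendstoI)
    fix e :: real assume "e > 0"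
    then obtain V where V: "openin (topo E) V" "l \<in> V" "\<And>x. x \<in> V \<Longrightarrow> q (x \<ominus> l) < e"
      using cont_seminorm_ball[OF q l] by blast
    then have "eventually (\<lambda>n. s n \<in> V) sequentially"
      using lim by (simp add: limitin_def)
    then show "eventually (\<lambda>n. dist (q (s n \<ominus> l)) 0 < e) sequentially"
    proof eventually_elim
      case (elim n)
      have "0 \<le> q (s n \<ominus> l)"
        using q l assms by (intro seminorm_nonneg) (auto simp: cont_seminorm_def)
      then show ?case using V(3)[OF elim] by simp
    qed
  qed
next
  assume l: "l \<in> carrier E" and q: "\<forall>q. cont_seminorm q \<longrightarrow> (\<lambda>n. q (s n \<ominus> l)) \<longlonglongrightarrow> 0"
  show "limitin (topo E) s l sequentially"
    unfolding limitin_def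
  proof (intro conjI allI impI)
    fix U assume U: "openin (topo E) U \<and> l \<in> U"
    then obtain p where p: "cont_seminorm p" "\<And>x. x \<in> carrier E \<Longrightarrow> p (x \<ominus> l) < 1 \<Longrightarrow> x \<in> U"
      using cont_seminorm_ball_in_open by blast
    have "eventually (\<lambda>n. p (s n \<ominus> l) < 1) sequentially"
      using order_tendstoD(2)[OF q[rule_format, OF p(1)], of 1] by simp
    then show "eventually (\<lambda>n. s n \<in> U) sequentially"
      by eventually_elim (use p(2) assms in auto)
  qed (simp add: l)
qed

lemma continuous_map_into_lcs:
  assumes f: "\<And>x. x \<in> topspace X \<Longrightarrow> f x \<in> carrier E"
    and loc: "\<And>a q. a \<in> topspace X \<Longrightarrow> cont_seminorm q \<Longrightarrow>
      \<exists>V. openin X V \<and> a \<in> V \<and> (\<forall>x\<in>V. q (f x \<ominus> f a) < 1)"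
  shows "continuous_map X (topo E) f"
  unfolding continuous_map_def
proof (intro conjI allI impI)
  show "f \<in> topspace X \<rightarrow> topspace (topo E)" using f by simp
  fix U assume U: "openin (topo E) U"
  show "openin X {x \<in> topspace X. f x \<in> U}"
  proof (subst openin_subopen, safe)
    fix a assume a: "a \<in> topspace X" "f a \<in> U"
    obtain q where q: "cont_seminorm q" "\<And>x. x \<in> carrier E \<Longrightarrow> q (x \<ominus> f a) < 1 \<Longrightarrow> x \<in> U"
      using cont_seminorm_ball_in_open U a(2) by blast
    obtain V where V: "openin X V" "a \<in> V" "\<forall>x\<in>V. q (f x \<ominus> f a) < 1"
      using loc a q(1) by blast
    then have "V \<subseteq> {x \<in> topspace X. f x \<in> U}"
      using q(2) f openin_subset by blast
    then show "\<exists>T. openin X T \<and> a \<in> T \<and> T \<subseteq> {x \<in> topspace X. f x \<in> U}"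
      using V by blast
  qed
qed

lemma dual_linear:
  assumes "\<phi> \<in> dual E"
  shows "x \<in> carrier E \<Longrightarrow> y \<in> carrier E \<Longrightarrow> \<phi> (x \<oplus> y) = \<phi> x + \<phi> y"
    "x \<in> carrier E \<Longrightarrow> \<phi> (c \<odot> x) = c * \<phi> x"
  using assms by (simp_all add: dual_def operator_def linear_map_on_def)

lemma dual_continuous: "\<phi> \<in> dual E \<Longrightarrow> continuous_map (topo E) euclidean \<phi>"
  by (simp add: dual_def operator_def)

lemma cont_seminorm_dual:
  assumes \<phi>: "\<phi> \<in> dual E"
  shows "cont_seminorm (\<lambda>x. norm (\<phi> x))"
proof -
  have "seminorm (\<lambda>x. norm (\<phi> x))"
    using \<phi> by (simp add: seminorm_def dual_linear norm_triangle_ineq norm_mult)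
  moreover have "openin (topo E) {x \<in> carrier E. \<phi> x \<in> ball 0 1}"
    using openin_continuous_map_preimage[OF dual_continuous[OF \<phi>], of "ball 0 1"] by simp
  moreover have "\<phi> \<zero> = 0" using dual_linear(2)[OF \<phi>, of \<zero> 0] by simp
  ultimately show ?thesis
    unfolding cont_seminorm_def
    by (intro conjI exI[of _ "{x \<in> carrier E. \<phi> x \<in> ball 0 1}"]) auto
qed

lemma dualI:
  assumes add: "\<And>x y. x \<in> carrier E \<Longrightarrow> y \<in> carrier E \<Longrightarrow> f (x \<oplus> y) = f x + f y"
    and smult: "\<And>c x. x \<in> carrier E \<Longrightarrow> f (c \<odot> x) = c * f x"
    and off: "\<And>x. x \<notin> carrier E \<Longrightarrow> f x = 0"
    and q: "cont_seminorm q" and bound: "\<And>x. x \<in> carrier E \<Longrightarrow> norm (f x) \<le> C * q x"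
  shows "f \<in> dual E"
proof -
  have "continuous_map (topo E) euclidean f"
    unfolding continuous_map_def
  proof (intro conjI allI impI)
    fix U :: "'k set" assume "openin euclidean U"
    then have U: "open U" by simp
    show "openin (topo E) {x \<in> topspace (topo E). f x \<in> U}"
    proof (subst openin_subopen, safe)
      fix a assume "a \<in> topspace (topo E)" and aU: "f a \<in> U"
      then have a: "a \<in> carrier E" by simp
      obtain e where e: "e > 0" "ball (f a) e \<subseteq> U"
        using U aU open_contains_ball by blast
      obtain V where V: "openin (topo E) V" "a \<in> V" "\<And>x. x \<in> V \<Longrightarrow> q (x \<ominus> a) < e / (\<bar>C\<bar> + 1)"
        using cont_seminorm_ball[OF q a, of "e / (\<bar>C\<bar> + 1)"] e(1) by auto
      have "x \<in> carrier E \<and> f x \<in> U" if "x \<in> V" for x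
      proof -
        have x: "x \<in> carrier E" using that V(1) openin_subset by fastforce
        have "f x - f a = f (x \<ominus> a)" using x a by (simp add: minus_eq add smult)
        then have "norm (f x - f a) \<le> C * q (x \<ominus> a)" using bound x a by simp
        also have "\<dots> \<le> \<bar>C\<bar> * q (x \<ominus> a)"
          using seminorm_nonneg[of q "x \<ominus> a"] q x a
          by (intro mult_right_mono) (auto simp: cont_seminorm_def)
        also have "\<dots> \<le> \<bar>C\<bar> * (e / (\<bar>C\<bar> + 1))"
          using V(3)[OF that] by (intro mult_left_mono) auto
        also have "\<dots> < e" using e(1) by (simp add: field_simps)
        finally have "f x \<in> ball (f a) e" by (simp add: dist_norm norm_minus_commute)
        then show ?thesis using x e(2) by blast
      qed
      then show "\<exists>T. openin (topo E) T \<and> a \<in> T \<and> T \<subseteq> {x \<in> topspace (topo E). f x \<in> U}"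
        using V by (intro exI[of _ V]) auto
    qed
  qed simp
  then show ?thesis
    using add smult off by (simp add: dual_def operator_def linear_map_on_def)
qed

end

section \<open>The Hahn-Banach theorem\<close>

context vec
begin

text \<open>
The Hahn-Banach theorem is obtained without extending functionals from subspaces: a minimal
sublinear functional is linear, so Zorn's lemma is applied to sublinear functionals on the whole
space, ordered pointwise.
\<close>

definition sublinear :: "('a \<Rightarrow> real) \<Rightarrow> bool" where
  "sublinear f \<longleftrightarrow> (\<forall>x\<in>carrier E. \<forall>y\<in>carrier E. f (x \<oplus> y) \<le> f x + f y) \<and>
     (\<forall>r\<ge>0. \<forall>x\<in>carrier E. f (of_real r \<odot> x) = r * f x)"

lemma sublinear_add: "sublinear f \<Longrightarrow> x \<in> carrier E \<Longrightarrow> y \<in> carrier E \<Longrightarrow> f (x \<oplus> y) \<le> f x + f y"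
  by (simp add: sublinear_def)

lemma sublinear_scale: "sublinear f \<Longrightarrow> 0 \<le> r \<Longrightarrow> x \<in> carrier E \<Longrightarrow> f (of_real r \<odot> x) = r * f x"
  by (simp add: sublinear_def)

lemma sublinear_zero: "sublinear f \<Longrightarrow> f \<zero> = 0"
  using sublinear_scale[of f 0 \<zero>] by simp

lemma add_neg: "x \<in> carrier E \<Longrightarrow> x \<oplus> (-1) \<odot> x = \<zero>"
  by (metis diff_self minus_eq)

lemma sublinear_neg:
  assumes "sublinear f" "x \<in> carrier E" shows "0 \<le> f x + f ((-1) \<odot> x)"
  using sublinear_add[of f x "(-1) \<odot> x"] sublinear_zero[of f] add_neg[of x] assms by simp

text \<open>
The functional \<open>g x = inf {f (x \<oplus> t \<odot> y) - t * f y | t. t \<ge> 0}\<close> is again sublinear. It is at most \<open>f\<close>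
(take \<open>t = 0\<close>), and \<open>t = 1\<close> shows that it is at most \<open>- f y\<close> at \<open>- y\<close>.
\<close>

lemma sublinear_lower_at:
  assumes f: "sublinear f" and y: "y \<in> carrier E"
  obtains g where "sublinear g" "\<And>x. x \<in> carrier E \<Longrightarrow> g x \<le> f x" "g ((-1) \<odot> y) \<le> - f y"
proof -
  define S where "S x = (\<lambda>t. f (x \<oplus> of_real t \<odot> y) - t * f y) ` {0..}" for x
  define g where "g x = Inf (S x)" for x
  have lb: "- f ((-1) \<odot> x) \<le> f (x \<oplus> of_real t \<odot> y) - t * f y"
    if x: "x \<in> carrier E" and t: "0 \<le> t" for x t
  proof -
    have "(x \<oplus> of_real t \<odot> y) \<oplus> (-1) \<odot> x = of_real t \<odot> y"
      using x y add_diff_cancel(2)[of "of_real t \<odot> y" x] by (simp add: minus_eq M.M.a_comm)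
    then have "f (of_real t \<odot> y) \<le> f (x \<oplus> of_real t \<odot> y) + f ((-1) \<odot> x)"
      using sublinear_add[OF f, of "x \<oplus> of_real t \<odot> y" "(-1) \<odot> x"] x y by simp
    then show ?thesis using sublinear_scale[OF f t y] by simp
  qed
  have bdd: "bdd_below (S x)" if "x \<in> carrier E" for x
    using lb[OF that] by (intro bdd_belowI[of _ "- f ((-1) \<odot> x)"]) (auto simp: S_def)
  have lower: "g x \<le> f (x \<oplus> of_real t \<odot> y) - t * f y" if "x \<in> carrier E" "0 \<le> t" for x t
    using that bdd[of x] by (auto simp: g_def S_def intro!: cInf_lower)
  have greatest: "r \<le> g x"
    if "x \<in> carrier E" "\<And>t. 0 \<le> t \<Longrightarrow> r \<le> f (x \<oplus> of_real t \<odot> y) - t * f y" for r x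
    using that by (auto simp: g_def S_def intro!: cInf_greatest)
  have le: "g x \<le> f x" if "x \<in> carrier E" for x using lower[OF that, of 0] that y by simp
  have scale_le: "g (of_real r \<odot> x) \<le> r * g x" if x: "x \<in> carrier E" and r: "0 < r" for r x
  proof -
    have "g (of_real r \<odot> x) / r \<le> g x"
    proof (rule greatest[OF x])
      fix t :: real assume t: "0 \<le> t"
      have "of_real r \<odot> x \<oplus> of_real (r * t) \<odot> y = of_real r \<odot> (x \<oplus> of_real t \<odot> y)"
        using x y by (simp add: smult_add_right)
      then have "g (of_real r \<odot> x) \<le> r * f (x \<oplus> of_real t \<odot> y) - r * t * f y"
        using lower[of "of_real r \<odot> x" "r * t"] sublinear_scale[OF f, of r "x \<oplus> of_real t \<odot> y"] x y r t
        by simp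
      then show "g (of_real r \<odot> x) / r \<le> f (x \<oplus> of_real t \<odot> y) - t * f y"
        using r by (simp add: field_simps)
    qed
    then show ?thesis using r by (simp add: field_simps)
  qed
  have zero: "g \<zero> = 0"
  proof (rule antisym)
    show "g \<zero> \<le> 0" using le[of \<zero>] sublinear_zero[OF f] by simp
    show "0 \<le> g \<zero>"
      by (rule greatest) (use lb[of \<zero>] sublinear_zero[OF f] in auto)
  qed
  have "sublinear g"
    unfolding sublinear_def
  proof (intro conjI ballI allI impI)
    fix r :: real and x assume r: "0 \<le> r" and x: "x \<in> carrier E"
    show "g (of_real r \<odot> x) = r * g x"
    proof (cases "r = 0")
      case False
      then have pos: "0 < r" using r by simp
      have "g x \<le> g (of_real r \<odot> x) / r"
        using scale_le[of "of_real r \<odot> x" "1/r"] x pos by simp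
      then show ?thesis using scale_le[OF x pos] pos by (simp add: field_simps)
    qed (simp add: zero x)
  next
    fix x z assume x: "x \<in> carrier E" and z: "z \<in> carrier E"
    have st: "g (x \<oplus> z) \<le> (f (x \<oplus> of_real s \<odot> y) - s * f y) + (f (z \<oplus> of_real t \<odot> y) - t * f y)"
      if s: "0 \<le> s" and t: "0 \<le> t" for s t
    proof -
      have "(x \<oplus> z) \<oplus> of_real (s + t) \<odot> y = (x \<oplus> of_real s \<odot> y) \<oplus> (z \<oplus> of_real t \<odot> y)"
        using x y z by (simp add: smult_add_left add_add_swap)
      then show ?thesis
        using lower[of "x \<oplus> z" "s + t"] sublinear_add[OF f, of "x \<oplus> of_real s \<odot> y" "z \<oplus> of_real t \<odot> y"]
          x y z s t by (simp add: algebra_simps)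
    qed
    have "g (x \<oplus> z) - (f (x \<oplus> of_real s \<odot> y) - s * f y) \<le> g z" if "0 \<le> s" for s
      by (rule greatest[OF z]) (use st[OF that] in \<open>simp add: algebra_simps\<close>)
    then have "g (x \<oplus> z) - g z \<le> g x"
      by (intro greatest[OF x]) (simp add: algebra_simps)
    then show "g (x \<oplus> z) \<le> g x + g z" by simp
  qed
  moreover have "g ((-1) \<odot> y) \<le> - f y"
    using lower[of "(-1) \<odot> y" 1] y add_neg[OF y] sublinear_zero[OF f] by (simp add: M.M.a_comm)
  ultimately show ?thesis using that le by blast
qed

text \<open>
The pointwise infimum of a chain of sublinear functionals below \<open>f\<close> is finite, since each of them
is at least \<open>- f (- x)\<close> at \<open>x\<close>, and it is sublinear: subadditivity may be checked with
the smaller of two members of the chain.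
\<close>

lemma minimal_sublinear_below:
  assumes f: "sublinear f"
  obtains m where "sublinear m" "\<And>x. x \<in> carrier E \<Longrightarrow> m x \<le> f x"
    "\<forall>g. sublinear g \<and> (\<forall>x\<in>carrier E. g x \<le> m x) \<longrightarrow> (\<forall>x\<in>carrier E. g x = m x)"
proof -
  \<comment> \<open>values off the carrier are normalised to 0, so that the pointwise order is antisymmetric\<close>
  define A where "A = {g. sublinear g \<and> (\<forall>x\<in>carrier E. g x \<le> f x) \<and> (\<forall>x. x \<notin> carrier E \<longrightarrow> g x = 0)}"
  define P :: "('a \<Rightarrow> real) \<Rightarrow> ('a \<Rightarrow> real) \<Rightarrow> bool" where "P g h \<longleftrightarrow> h \<le> g" for g h
  have restr: "sublinear (\<lambda>x. if x \<in> carrier E then g x else 0)" if "sublinear g" for g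
    using that by (simp add: sublinear_def)
  have "\<exists>m\<in>A. \<forall>g\<in>A. P m g \<longrightarrow> g = m"
  proof (rule predicate_Zorn)
    show "partial_order_on A (relation_of P A)"
      by (auto simp: partial_order_on_def preorder_on_def refl_on_def trans_def antisym_def
          relation_of_def P_def)
    fix C assume "C \<in> Chains (relation_of P A)"
    then have CA: "C \<subseteq> A" and chain: "\<And>g h. g \<in> C \<Longrightarrow> h \<in> C \<Longrightarrow> h \<le> g \<or> g \<le> h"
      by (auto simp: Chains_def relation_of_def P_def)
    show "\<exists>u\<in>A. \<forall>g\<in>C. P g u"
    proof (cases "C = {}")
      case True
      then show ?thesis
        using f restr by (intro bexI[of _ "\<lambda>x. if x \<in> carrier E then f x else 0"]) (auto simp: A_def)
    next
      case False
      define u where "u x = Inf ((\<lambda>g. g x) ` C)" for x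
      have lb: "- f ((-1) \<odot> x) \<le> g x" if "g \<in> C" "x \<in> carrier E" for g x
      proof -
        have g: "sublinear g" "g ((-1) \<odot> x) \<le> f ((-1) \<odot> x)" using that CA by (auto simp: A_def)
        then show ?thesis using sublinear_neg[OF g(1) that(2)] by linarith
      qed
      have off: "g x = 0" if "g \<in> C" "x \<notin> carrier E" for g x using that CA by (auto simp: A_def)
      have bdd: "bdd_below ((\<lambda>g. g x) ` C)" for x
      proof (cases "x \<in> carrier E")
        case True
        then show ?thesis using lb by (intro bdd_belowI[of _ "- f ((-1) \<odot> x)"]) auto
      next
        case x: False
        have "0 \<le> g x" if "g \<in> C" for g using off[OF that x] by simp
        then show ?thesis by (rule bdd_belowI2)
      qed
      have lower: "u x \<le> g x" if "g \<in> C" for g x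
        unfolding u_def using that bdd by (intro cInf_lower) auto
      have greatest: "r \<le> u x" if "\<And>g. g \<in> C \<Longrightarrow> r \<le> g x" for r x
        unfolding u_def using that False by (intro cInf_greatest) auto
      have scale_le: "u (of_real r \<odot> x) \<le> r * u x" if x: "x \<in> carrier E" and r: "0 < r" for r x
      proof -
        have "u (of_real r \<odot> x) / r \<le> u x"
        proof (rule greatest)
          fix g assume g: "g \<in> C"
          then have "sublinear g" using CA by (auto simp: A_def)
          then show "u (of_real r \<odot> x) / r \<le> g x"
            using lower[OF g, of "of_real r \<odot> x"] r x by (simp add: sublinear_scale field_simps)
        qed
        then show ?thesis using r by (simp add: field_simps)
      qed
      obtain g0 where g0: "g0 \<in> C" using False by blast
      have zero: "u \<zero> = 0"
      proof -
        have "g \<zero> = 0" if "g \<in> C" for g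
          using that CA sublinear_zero[of g] by (auto simp: A_def)
        then have "(\<lambda>g. g \<zero>) ` C = (\<lambda>g. 0) ` C" by (intro image_cong) simp_all
        then show ?thesis using False by (simp add: u_def image_constant_conv)
      qed
      have "sublinear u"
        unfolding sublinear_def
      proof (intro conjI ballI allI impI)
        fix r :: real and x assume r: "0 \<le> r" and x: "x \<in> carrier E"
        show "u (of_real r \<odot> x) = r * u x"
        proof (cases "r = 0")
          case False
          then have pos: "0 < r" using r by simp
          have "u x \<le> u (of_real r \<odot> x) / r"
            using scale_le[of "of_real r \<odot> x" "1/r"] x pos by simp
          then show ?thesis using scale_le[OF x pos] pos by (simp add: field_simps)
        qed (simp add: zero x)
      next
        fix x z assume x: "x \<in> carrier E" and z: "z \<in> carrier E"
        have gh: "u (x \<oplus> z) \<le> g x + h z" if g: "g \<in> C" and h: "h \<in> C" for g h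
        proof -
          have sub: "sublinear g" "sublinear h" using g h CA by (auto simp: A_def)
          show ?thesis
            using chain[OF g h]
          proof
            assume "h \<le> g"
            then show ?thesis
              using lower[OF h, of "x \<oplus> z"] sublinear_add[OF sub(2) x z] le_funD[of h g x] by linarith
          next
            assume "g \<le> h"
            then show ?thesis
              using lower[OF g, of "x \<oplus> z"] sublinear_add[OF sub(1) x z] le_funD[of g h z] by linarith
          qed
        qed
        have "u (x \<oplus> z) - g x \<le> u z" if "g \<in> C" for g
          by (rule greatest) (use gh[OF that] in \<open>simp add: algebra_simps\<close>)
        then have "u (x \<oplus> z) - u z \<le> u x"
          by (intro greatest) (simp add: algebra_simps)
        then show "u (x \<oplus> z) \<le> u x + u z" by simp
      qed
      moreover have "u x \<le> f x" if "x \<in> carrier E" for x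
        using lower[OF g0, of x] g0 CA that by (force simp: A_def)
      moreover have "u x = 0" if "x \<notin> carrier E" for x
      proof -
        have "(\<lambda>g. g x) ` C = (\<lambda>g. 0) ` C" by (rule image_cong) (simp_all add: off that)
        then show ?thesis using False by (simp add: u_def image_constant_conv)
      qed
      ultimately have "u \<in> A" by (auto simp: A_def)
      moreover have "P g u" if "g \<in> C" for g using lower[OF that] by (simp add: P_def le_funI)
      ultimately show ?thesis by blast
    qed
  qed
  then obtain m where m: "m \<in> A" and min: "\<And>g. g \<in> A \<Longrightarrow> g \<le> m \<Longrightarrow> g = m"
    unfolding P_def by blast
  show ?thesis
  proof (rule that[of m])
    show "sublinear m" "\<And>x. x \<in> carrier E \<Longrightarrow> m x \<le> f x" using m by (auto simp: A_def)
    show "\<forall>g. sublinear g \<and> (\<forall>x\<in>carrier E. g x \<le> m x) \<longrightarrow> (\<forall>x\<in>carrier E. g x = m x)"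
    proof (intro allI impI ballI, elim conjE)
      fix g x assume g: "sublinear g" "\<forall>x\<in>carrier E. g x \<le> m x" and x: "x \<in> carrier E"
      let ?g = "\<lambda>x. if x \<in> carrier E then g x else 0"
      have "?g \<le> m" using m g(2) by (auto simp: le_fun_def A_def)
      moreover have "?g \<in> A"
        using m g restr[OF g(1)] by (force simp: A_def)
      ultimately have "?g = m" using min by blast
      then have "?g x = m x" by (rule fun_cong)
      then show "g x = m x" using x by simp
    qed
  qed
qed

text \<open>
A minimal sublinear \<open>m\<close> cannot be lowered at any \<open>y\<close>, so \<open>m (- y) = - m y\<close> and subadditivity
becomes additivity. Lowering \<open>f\<close> at \<open>a\<close> before passing to a minimal functional forces the value at \<open>a\<close>.
\<close>

lemma real_linear_minorant:
  assumes f: "sublinear f" and a: "a \<in> carrier E"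
  obtains m where "\<And>x y. x \<in> carrier E \<Longrightarrow> y \<in> carrier E \<Longrightarrow> m (x \<oplus> y) = m x + m y"
    "\<And>r x. x \<in> carrier E \<Longrightarrow> m (of_real r \<odot> x) = r * m x"
    "\<And>x. x \<in> carrier E \<Longrightarrow> m x \<le> f x" "f a \<le> m a"
proof -
  obtain g where g: "sublinear g" "\<And>x. x \<in> carrier E \<Longrightarrow> g x \<le> f x" "g ((-1) \<odot> a) \<le> - f a"
    by (rule sublinear_lower_at[OF f a]) (rule that)
  obtain m where m: "sublinear m" "\<And>x. x \<in> carrier E \<Longrightarrow> m x \<le> g x"
    and min: "\<forall>g. sublinear g \<and> (\<forall>x\<in>carrier E. g x \<le> m x) \<longrightarrow> (\<forall>x\<in>carrier E. g x = m x)"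
    by (rule minimal_sublinear_below[OF g(1)]) (rule that)
  have neg: "m ((-1) \<odot> y) = - m y" if y: "y \<in> carrier E" for y
  proof (rule antisym)
    obtain h where h: "sublinear h" "\<And>x. x \<in> carrier E \<Longrightarrow> h x \<le> m x" "h ((-1) \<odot> y) \<le> - m y"
      by (rule sublinear_lower_at[OF m(1) y]) (rule that)
    show "m ((-1) \<odot> y) \<le> - m y" using min[rule_format, of h "(-1) \<odot> y"] h y by simp
    show "- m y \<le> m ((-1) \<odot> y)" using sublinear_neg[OF m(1) y] by simp
  qed
  show ?thesis
  proof (rule that[of m])
    fix x y assume x: "x \<in> carrier E" and y: "y \<in> carrier E"
    have "m ((-1) \<odot> (x \<oplus> y)) \<le> m ((-1) \<odot> x) + m ((-1) \<odot> y)"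
      using x y sublinear_add[OF m(1), of "(-1) \<odot> x" "(-1) \<odot> y"] by (simp add: smult_add_right)
    then have "m x + m y \<le> m (x \<oplus> y)" using neg x y by simp
    then show "m (x \<oplus> y) = m x + m y" using sublinear_add[OF m(1) x y] by simp
  next
    fix r x assume x: "x \<in> carrier E"
    show "m (of_real r \<odot> x) = r * m x"
    proof (cases "0 \<le> r")
      case False
      have "of_real r \<odot> x = (-1) \<odot> (of_real (- r) \<odot> x)" using x by simp
      then have "m (of_real r \<odot> x) = - m (of_real (- r) \<odot> x)"
        using neg[of "of_real (- r) \<odot> x"] x by simp
      then show ?thesis using sublinear_scale[OF m(1), of "- r" x] False x by simp
    qed (simp add: sublinear_scale m(1) x)
  next
    show "m x \<le> f x" if "x \<in> carrier E" for x using m(2) g(2) that by force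
    show "f a \<le> m a" using m(2)[of "(-1) \<odot> a"] g(3) neg[OF a] a by simp
  qed
qed

text \<open>
Complex scalars are handled by \<open>f x = m x - \<iota> m (\<iota> x)\<close> for a real-linear \<open>m \<le> q\<close> with \<open>m a = q a\<close>. The
factor 2 is harmless for the application and comes from the crude bound
\<open>norm (f x) \<le> \<bar>m x\<bar> + \<bar>m (\<iota> x)\<bar>\<close>.
\<close>

lemma linear_functional_with_large_value:
  assumes q: "seminorm q" and a: "a \<in> carrier E"
  obtains f where "linear_map_on E scalar_space f"
    "\<And>x. x \<in> carrier E \<Longrightarrow> norm (f x) \<le> 2 * q x" "q a \<le> norm (f a)"
proof -
  have "sublinear q"
    using q by (simp add: sublinear_def seminorm_add seminorm_smult)
  then obtain m where m: "\<And>x y. x \<in> carrier E \<Longrightarrow> y \<in> carrier E \<Longrightarrow> m (x \<oplus> y) = m x + m y"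
    "\<And>r x. x \<in> carrier E \<Longrightarrow> m (of_real r \<odot> x) = r * m x"
    "\<And>x. x \<in> carrier E \<Longrightarrow> m x \<le> q x" "q a \<le> m a"
    by (rule real_linear_minorant[OF _ a]) (rule that)
  have abs_m: "\<bar>m x\<bar> \<le> q x" if x: "x \<in> carrier E" for x
    using m(3)[OF x] m(3)[of "(-1) \<odot> x"] m(2)[OF x, of "-1"] seminorm_smult[OF q x, of "-1"] x by simp
  show ?thesis
  proof (cases rule: real_or_complex_cases[where 'k='k])
    case real
    have "linear_map_on E scalar_space (\<lambda>x. of_real (m x) :: 'k)"
      unfolding linear_map_on_def
    proof (intro conjI allI ballI)
      fix c :: 'k and x assume x: "x \<in> carrier E"
      obtain r where "c = of_real r" using real by blast
      then show "of_real (m (c \<odot> x)) = c \<odot>\<^bsub>scalar_space\<^esub> (of_real (m x) :: 'k)" using m(2) x by simp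
    qed (simp_all add: m(1))
    moreover have "norm (of_real (m x) :: 'k) \<le> 2 * q x" if "x \<in> carrier E" for x
      using abs_m[OF that] by simp
    moreover have "q a \<le> norm (of_real (m a) :: 'k)" using m(4) by simp
    ultimately show ?thesis by (rule that)
  next
    case (complex \<iota>)
    define f where "f x = of_real (m x) + of_real (- m (\<iota> \<odot> x)) * \<iota>" for x
    have ii: "\<iota> * (\<iota> * z) = - z" for z using complex(1) by (simp flip: mult.assoc)
    have add: "f (x \<oplus> y) = f x + f y" if "x \<in> carrier E" "y \<in> carrier E" for x y
      using that by (simp add: f_def m(1) smult_add_right algebra_simps)
    have smult: "f (c \<odot> x) = c * f x" if x: "x \<in> carrier E" for c x
    proof -
      obtain r s where c: "c = of_real r + of_real s * \<iota>" using complex(3) by blast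
      have "c \<odot> x = of_real r \<odot> x \<oplus> of_real s \<odot> (\<iota> \<odot> x)"
        unfolding c using x by (simp add: smult_add_left)
      then have 1: "m (c \<odot> x) = r * m x + s * m (\<iota> \<odot> x)" using x by (simp only: m closed)
      have "\<iota> * c = of_real r * \<iota> + of_real (- s)"
        unfolding c by (simp add: algebra_simps ii complex(1))
      then have "\<iota> \<odot> (c \<odot> x) = of_real r \<odot> (\<iota> \<odot> x) \<oplus> of_real (- s) \<odot> x"
        using smult_add_left[OF x, of "of_real r * \<iota>" "of_real (- s)"] x by simp
      then have 2: "m (\<iota> \<odot> (c \<odot> x)) = r * m (\<iota> \<odot> x) - s * m x"
        using x by (simp only: m closed)
      show ?thesis
        unfolding f_def 1 2 unfolding c by (simp add: algebra_simps ii complex(1))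
    qed
    have "linear_map_on E scalar_space f"
      by (simp add: linear_map_on_def add smult)
    moreover have "norm (f x) \<le> 2 * q x" if x: "x \<in> carrier E" for x
    proof -
      have "norm (f x) \<le> \<bar>m x\<bar> + \<bar>m (\<iota> \<odot> x)\<bar>"
        unfolding f_def using complex(2) by (intro norm_triangle_le) (simp add: norm_mult)
      also have "\<dots> \<le> q x + q (\<iota> \<odot> x)" using abs_m x by (intro add_mono) auto
      also have "\<dots> = 2 * q x" using seminorm_smult[OF q x, of \<iota>] complex(2) by simp
      finally show ?thesis .
    qed
    moreover have "q a \<le> norm (f a)"
      using m(4) complex(4)[of "m a" "- m (\<iota> \<odot> a)"] by (simp add: f_def)
    ultimately show ?thesis by (rule that)
  qed
qed

end

section \<open>Weakly bounded sets are bounded\<close>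

text \<open>
If \<open>q\<close> is unbounded on \<open>A\<close>, choose \<open>a n \<in> A\<close> with \<open>q (a n) \<ge> 10 ^ n\<close> and functionals \<open>\<psi> n\<close>, bounded by
\<open>2 q\<close>, with \<open>norm (\<psi> n (a n)) \<ge> q (a n)\<close>. For suitable signs \<open>\<sigma> n\<close> the sum of the \<open>\<sigma> n * \<psi> n / 5 ^ n\<close> is a continuous
functional that is unbounded on the \<open>a n\<close>. The sign \<open>\<sigma> n\<close> is chosen so that the partial sum
including the \<open>n\<close>-th term is at least \<open>q (a n) / 5 ^ n\<close> at \<open>a n\<close>. The ratio \<open>1/5\<close> makes the remaining
terms contribute at most half of that.
\<close>

lemma (in lcs) seminorm_bounded_if_weakly_bounded:
  assumes A: "A \<subseteq> carrier E" and weak: "\<And>\<phi>. \<phi> \<in> dual E \<Longrightarrow> \<exists>M. \<forall>a\<in>A. norm (\<phi> a) \<le> M"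
    and q: "cont_seminorm q"
  shows "\<exists>M. \<forall>a\<in>A. q a \<le> M"
proof (rule ccontr)
  assume unb: "\<nexists>M. \<forall>a\<in>A. q a \<le> M"
  have sq: "seminorm q" using q by (simp add: cont_seminorm_def)
  have "\<exists>a. a \<in> A \<and> 10 ^ n \<le> q a" for n :: nat using unb by (meson linear)
  then obtain a where aA: "\<And>n. a n \<in> A" and qa: "\<And>n. 10 ^ n \<le> q (a n)" by metis
  have ac: "a n \<in> carrier E" for n using aA A by blast
  have "\<exists>f. linear_map_on E scalar_space f \<and> (\<forall>x\<in>carrier E. norm (f x) \<le> 2 * q x) \<and>
      q (a n) \<le> norm (f (a n))" for n
    using linear_functional_with_large_value[OF sq ac] by metis
  then obtain \<psi> where lin: "\<And>n. linear_map_on E scalar_space (\<psi> n)"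
    and le: "\<And>n x. x \<in> carrier E \<Longrightarrow> norm (\<psi> n x) \<le> 2 * q x"
    and ge: "\<And>n. q (a n) \<le> norm (\<psi> n (a n))" by metis
  \<comment> \<open>the partial sums; the sign of each term depends on the previous partial sum\<close>
  define \<theta> where "\<theta> = rec_nat (\<lambda>x. 0) (\<lambda>n f x.
      if q (a n) / 5 ^ n \<le> norm (f (a n) + \<psi> n (a n) / 5 ^ n)
      then f x + \<psi> n x / 5 ^ n else f x - \<psi> n x / 5 ^ n)"
  define \<sigma> :: "nat \<Rightarrow> 'k" where
    "\<sigma> n = (if q (a n) / 5 ^ n \<le> norm (\<theta> n (a n) + \<psi> n (a n) / 5 ^ n) then 1 else - 1)" for n
  have \<theta>_Suc: "\<theta> (Suc n) x = \<theta> n x + \<sigma> n * \<psi> n x / 5 ^ n" for n x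
    by (simp add: \<theta>_def \<sigma>_def)
  have \<theta>_sum: "\<theta> n x = (\<Sum>k<n. \<sigma> k * \<psi> k x / 5 ^ k)" for n x
    by (induction n) (simp_all add: \<theta>_Suc, simp add: \<theta>_def)
  have \<sigma>: "norm (\<sigma> n) = 1" for n by (simp add: \<sigma>_def)
  have term_le: "norm (\<sigma> k * \<psi> k x / 5 ^ k) \<le> 2 * q x * (1/5) ^ k" if "x \<in> carrier E" for k x
    using le[OF that, of k] \<sigma>[of k]
    by (simp add: norm_mult norm_divide norm_power power_one_over divide_right_mono)
  \<comment> \<open>\<open>u + v\<close> and \<open>u - v\<close> differ by \<open>2 v\<close>, so one of them has norm at least \<open>norm v\<close>\<close>
  have hump: "q (a n) / 5 ^ n \<le> norm (\<theta> (Suc n) (a n))" for n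
  proof (rule ccontr)
    assume *: "\<not> ?thesis"
    let ?u = "\<theta> n (a n)" and ?v = "\<psi> n (a n) / 5 ^ n"
    have "\<not> q (a n) / 5 ^ n \<le> norm (?u + ?v)" using * by (auto simp: \<theta>_Suc \<sigma>_def)
    moreover from this have "\<not> q (a n) / 5 ^ n \<le> norm (?u - ?v)" using * by (simp add: \<theta>_Suc \<sigma>_def)
    moreover have "norm ((?u + ?v) - (?u - ?v)) \<le> norm (?u + ?v) + norm (?u - ?v)"
      by (rule norm_triangle_ineq4)
    moreover have "norm ((?u + ?v) - (?u - ?v)) = 2 * (norm (\<psi> n (a n)) / 5 ^ n)"
    proof -
      have "(?u + ?v) - (?u - ?v) = 2 * ?v" by simp
      then show ?thesis by (simp add: norm_mult norm_divide norm_power del: add_diff_cancel)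
    qed
    moreover have "q (a n) / 5 ^ n \<le> norm (\<psi> n (a n)) / 5 ^ n"
      using ge by (intro divide_right_mono) auto
    ultimately show False by linarith
  qed
  have geo: "summable (\<lambda>k. C * (1/5::real) ^ k)" for C by (intro summable_mult) simp
  have sum: "summable (\<lambda>k. \<sigma> k * \<psi> k x / 5 ^ k)" if "x \<in> carrier E" for x
    using summable_comparison_test'[OF geo term_le[OF that]] by simp
  define \<rho> where "\<rho> x = (if x \<in> carrier E then (\<Sum>k. \<sigma> k * \<psi> k x / 5 ^ k) else 0)" for x
  have "\<rho> \<in> dual E"
  proof (rule dualI[OF _ _ _ q, where C = "5/2"])
    fix x y assume x: "x \<in> carrier E" and y: "y \<in> carrier E"
    have "\<sigma> k * \<psi> k (x \<oplus> y) / 5 ^ k = \<sigma> k * \<psi> k x / 5 ^ k + \<sigma> k * \<psi> k y / 5 ^ k" for k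
      using lin[of k] x y by (simp add: linear_map_on_def field_simps)
    then show "\<rho> (x \<oplus> y) = \<rho> x + \<rho> y" using x y by (simp add: \<rho>_def suminf_add sum)
  next
    fix c x assume x: "x \<in> carrier E"
    have eq: "\<sigma> k * \<psi> k (c \<odot> x) / 5 ^ k = c * (\<sigma> k * \<psi> k x / 5 ^ k)" for k
      using lin[of k] x by (simp add: linear_map_on_def field_simps)
    show "\<rho> (c \<odot> x) = c * \<rho> x" using x by (simp only: \<rho>_def eq suminf_mult[OF sum] closed if_True)
  next
    fix x assume x: "x \<in> carrier E"
    have "norm (\<Sum>k. \<sigma> k * \<psi> k x / 5 ^ k) \<le> (\<Sum>k. 2 * q x * (1/5) ^ k)"
      by (rule norm_suminf_le[OF term_le[OF x] geo])
    also have "\<dots> = 5/2 * q x" by (subst suminf_mult) (simp_all add: suminf_geometric)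
    finally show "norm (\<rho> x) \<le> 5/2 * q x" using x by (simp add: \<rho>_def)
  qed (simp add: \<rho>_def)
  then obtain M where M: "\<And>n. norm (\<rho> (a n)) \<le> M" using weak aA by blast
  have "2 ^ n / 2 \<le> norm (\<rho> (a n))" for n
  proof -
    let ?t = "\<lambda>k. \<sigma> k * \<psi> k (a n) / 5 ^ k"
    have "\<rho> (a n) = (\<Sum>k. ?t (k + Suc n)) + \<theta> (Suc n) (a n)"
      using suminf_split_initial_segment[OF sum[OF ac], of n "Suc n"] ac
      by (simp add: \<rho>_def \<theta>_sum)
    then have split: "\<theta> (Suc n) (a n) = \<rho> (a n) - (\<Sum>k. ?t (k + Suc n))" by simp
    have "norm (\<Sum>k. ?t (k + Suc n)) \<le> (\<Sum>k. 2 * q (a n) * (1/5) ^ Suc n * (1/5) ^ k)"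
    proof (rule norm_suminf_le[OF _ geo])
      fix k show "norm (?t (k + Suc n)) \<le> 2 * q (a n) * (1/5) ^ Suc n * (1/5) ^ k"
        using term_le[OF ac, of "k + Suc n" n] by (simp add: power_add mult_ac)
    qed
    also have "\<dots> = q (a n) / 5 ^ n / 2"
      by (subst suminf_mult) (simp_all add: suminf_geometric power_one_over)
    finally have "q (a n) / 5 ^ n / 2 \<le> norm (\<rho> (a n))"
      using hump[of n] norm_triangle_ineq4[of "\<rho> (a n)" "\<Sum>k. ?t (k + Suc n)"] split by simp
    moreover have "(10::real) ^ n / 5 ^ n \<le> q (a n) / 5 ^ n" by (rule divide_right_mono[OF qa]) simp
    moreover have "(10::real) ^ n / 5 ^ n = 2 ^ n" by (simp flip: power_divide)
    ultimately show ?thesis by simp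
  qed
  then have "2 ^ n / 2 \<le> M" for n using M[of n] by (rule order_trans)
  moreover obtain n where "2 * M < 2 ^ n" using real_arch_pow[of 2 "2 * M"] by auto
  ultimately show False by (simp add: not_le[symmetric] divide_le_eq mult.commute)
qed

section \<open>The weak and the strong topology\<close>

context lcs
begin

lemma zero_in_dual: "(\<lambda>x. 0) \<in> dual E"
proof (rule dualI[where q = "\<lambda>x. 0" and C = 0])
  show "cont_seminorm (\<lambda>x. 0)"
    unfolding cont_seminorm_def seminorm_def using openin_topspace[of "topo E"]
    by (intro conjI exI[of _ "carrier E"]) auto
qed simp_all

lemma smult_in_dual: "\<phi> \<in> dual E \<Longrightarrow> (\<lambda>x. c * \<phi> x) \<in> dual E"
proof (rule dualI[where q = "\<lambda>x. norm (\<phi> x)" and C = "norm c"])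
  assume \<phi>: "\<phi> \<in> dual E"
  then show "c * \<phi> x = 0" if "x \<notin> carrier E" for x using that by (simp add: dual_def)
  show "cont_seminorm (\<lambda>x. norm (\<phi> x))" using \<phi> by (rule cont_seminorm_dual)
qed (simp_all add: dual_linear algebra_simps norm_mult)

lemma topspace_weak_topology: "topspace (weak_topology E) = carrier E"
proof -
  have "carrier E \<in> {{x \<in> carrier E. \<phi> x \<in> V} | \<phi> V. \<phi> \<in> dual E \<and> open V}"
    using zero_in_dual by (intro CollectI exI[of _ "\<lambda>x. 0"] exI[of _ UNIV]) simp
  then show ?thesis unfolding weak_topology_def topology_generated_by_topspace by blast
qed

text \<open>
Multiplying a functional by a scalar gives a functional, so the generators of the weak topology pull back to generators.
\<close>

lemma continuous_map_weak_smult: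
  "continuous_map (weak_topology E) (weak_topology E) (\<lambda>x. c \<odot> x)"
proof -
  let ?\<S> = "{{x \<in> carrier E. \<phi> x \<in> V} | \<phi> V. \<phi> \<in> dual E \<and> open V}"
  have "continuous_map (weak_topology E) (topology_generated_by ?\<S>) (\<lambda>x. c \<odot> x)"
  proof (rule continuous_on_generated_topo)
    fix U assume "U \<in> ?\<S>"
    then obtain \<phi> V where U: "U = {x \<in> carrier E. \<phi> x \<in> V}" "\<phi> \<in> dual E" "open V" by blast
    have "(\<lambda>x. c \<odot> x) -` U \<inter> topspace (weak_topology E) = {x \<in> carrier E. c * \<phi> x \<in> V}"
      using U(2) by (auto simp: U(1) topspace_weak_topology dual_linear)
    also have "\<dots> \<in> ?\<S>" 
      using smult_in_dual[OF U(2), of c] U(3)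
      by (intro CollectI exI[of _ "\<lambda>x. c * \<phi> x"] exI[of _ V]) simp
    finally show "openin (weak_topology E) ((\<lambda>x. c \<odot> x) -` U \<inter> topspace (weak_topology E))"
      unfolding weak_topology_def by (rule topology_generated_by_Basis)
  next
    show "(\<lambda>x. c \<odot> x) ` topspace (weak_topology E) \<subseteq> \<Union> ?\<S>"
      using topspace_weak_topology unfolding weak_topology_def topology_generated_by_topspace by auto
  qed
  then show ?thesis by (simp add: weak_topology_def)
qed

lemma limitin_weak_smultD:
  assumes x: "range x \<subseteq> carrier E" and c: "c \<noteq> 0"
    and lim: "limitin (weak_topology E) (\<lambda>n. c \<odot> x n) l sequentially"
  shows "limitin (weak_topology E) x (inverse c \<odot> l) sequentially"
proof -
  have "(\<lambda>x. inverse c \<odot> x) \<circ> (\<lambda>n. c \<odot> x n) = x"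
    using range_subsetD[OF x] c by (simp add: fun_eq_iff)
  then show ?thesis using continuous_map_limit[OF continuous_map_weak_smult lim, of "inverse c"] by simp
qed

lemma weakly_Cauchy_smultD:
  assumes x: "range x \<subseteq> carrier E" and c: "c \<noteq> 0" and Cauchy: "weakly_Cauchy E (\<lambda>n. c \<odot> x n)"
  shows "weakly_Cauchy E x"
  unfolding weakly_Cauchy_def
proof (intro conjI allI impI x)
  fix U assume U: "openin (weak_topology E) U \<and> \<zero> \<in> U"
  let ?U = "{x \<in> carrier E. inverse c \<odot> x \<in> U}"
  have "openin (weak_topology E) ?U \<and> \<zero> \<in> ?U"
    using openin_continuous_map_preimage[OF continuous_map_weak_smult[of "inverse c"], of U] U
    by (simp add: topspace_weak_topology)
  then have "\<exists>M. \<forall>m\<ge>M. \<forall>n\<ge>M. c \<odot> x m \<ominus> c \<odot> x n \<in> ?U"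
    using Cauchy unfolding weakly_Cauchy_def by (elim conjE allE[of _ ?U] mp) (rule conjI)
  then obtain M where M: "\<And>m n. m \<ge> M \<Longrightarrow> n \<ge> M \<Longrightarrow> c \<odot> x m \<ominus> c \<odot> x n \<in> ?U"
    by blast
  have "x m \<ominus> x n \<in> U" if "m \<ge> M" "n \<ge> M" for m n
  proof -
    have xs: "x m \<in> carrier E" "x n \<in> carrier E" using x by auto
    then have "inverse c \<odot> (c \<odot> (x m \<ominus> x n)) \<in> U" using M[OF that] by (simp add: smult_diff_right)
    then show ?thesis using xs c by (simp only: smult_simps closed) (simp add: xs)
  qed
  then show "\<exists>N. \<forall>m\<ge>N. \<forall>n\<ge>N. x m \<ominus> x n \<in> U" by blast
qed

lemma weakly_seq_precompact_smultD:
  fixes x :: "nat \<Rightarrow> 'a"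
  assumes B: "weakly_seq_precompact E B" and x: "range x \<subseteq> carrier E" and c: "c \<noteq> 0"
    and cx: "\<And>n. c \<odot> x n \<in> B"
  shows "\<exists>r. strict_mono r \<and> weakly_Cauchy E (x \<circ> r)"
proof -
  have sub: "range (\<lambda>n. c \<odot> x n) \<subseteq> B" using cx by blast
  obtain r where r: "strict_mono r" "weakly_Cauchy E ((\<lambda>n. c \<odot> x n) \<circ> r)"
    using B[unfolded weakly_seq_precompact_def, THEN conjunct2, THEN spec, THEN mp, OF sub] by blast
  have "weakly_Cauchy E (x \<circ> r)"
    by (rule weakly_Cauchy_smultD[OF _ c]) (use x r(2) in \<open>auto simp: o_def\<close>)
  then show ?thesis using r(1) by blast
qed

lemma rel_weakly_seq_compact_smultD:
  fixes x :: "nat \<Rightarrow> 'a"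
  assumes B: "rel_weakly_seq_compact E B" and x: "range x \<subseteq> carrier E" and c: "c \<noteq> 0"
    and cx: "\<And>n. c \<odot> x n \<in> B"
  shows "\<exists>r. strict_mono r \<and> (\<exists>l\<in>carrier E. limitin (weak_topology E) (x \<circ> r) l sequentially)"
proof -
  have sub: "range (\<lambda>n. c \<odot> x n) \<subseteq> B" using cx by blast
  obtain r l where r: "strict_mono r" "l \<in> carrier E"
      "limitin (weak_topology E) ((\<lambda>n. c \<odot> x n) \<circ> r) l sequentially"
    using B[unfolded rel_weakly_seq_compact_def, THEN conjunct2, THEN spec, THEN mp, OF sub] by blast
  have "limitin (weak_topology E) (x \<circ> r) (inverse c \<odot> l) sequentially"
    by (rule limitin_weak_smultD[OF _ c]) (use x r(3) in \<open>auto simp: o_def\<close>)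
  then show ?thesis using r(1,2) by blast
qed

end

lemma strong_dual_simps [simp]:
  "carrier (strong_dual E) = dual E" "zero (strong_dual E) = (\<lambda>x. 0)"
  "smult (strong_dual E) = (\<lambda>c f x. c * f x)" "topo (strong_dual E) = strong_topology E"
  by (simp_all add: strong_dual_def)

text \<open>
The set of functionals bounded by \<open>\<epsilon>\<close> on \<open>B\<close> need not be open, but those bounded by some \<open>\<delta> < \<epsilon>\<close> form an
open set.
\<close>

lemma limitin_strong_topology_zero_iff:
  assumes zero: "(\<lambda>x. 0) \<in> dual E" and f: "\<And>n. f n \<in> dual E"
  shows "limitin (strong_topology E) f (\<lambda>x. 0) sequentially \<longleftrightarrow>
    (\<forall>B \<epsilon>. bounded_in E B \<longrightarrow> 0 < \<epsilon> \<longrightarrow> (\<forall>\<^sub>F n in sequentially. \<forall>b\<in>B. norm (f n b) \<le> \<epsilon>))"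
proof (intro iffI allI impI)
  fix B and \<epsilon> :: real
  assume lim: "limitin (strong_topology E) f (\<lambda>x. 0) sequentially" and B: "bounded_in E B" and \<epsilon>: "0 < \<epsilon>"
  let ?W = "{g \<in> dual E. \<exists>\<delta><\<epsilon>. \<forall>b\<in>B. norm (g b) \<le> \<delta>}"
  have "openin (strong_topology E) ?W"
    unfolding openin_strong_topology
  proof (intro conjI ballI)
    fix g assume "g \<in> ?W"
    then obtain \<delta> where \<delta>: "\<delta> < \<epsilon>" "\<forall>b\<in>B. norm (g b) \<le> \<delta>" by blast
    have "h \<in> ?W" if h: "h \<in> dual E" "\<forall>b\<in>B. norm (h b - g b) \<le> (\<epsilon> - \<delta>) / 2" for h
    proof -
      have "norm (h b) \<le> (\<epsilon> + \<delta>) / 2" if "b \<in> B" for b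
      proof -
        have "norm (h b) \<le> norm (h b - g b) + norm (g b)"
          by (metis diff_add_cancel norm_triangle_ineq)
        also have "\<dots> \<le> (\<epsilon> - \<delta>) / 2 + \<delta>" using h(2) \<delta>(2) that by (intro add_mono) auto
        finally show ?thesis by (simp add: field_simps)
      qed
      moreover have "(\<epsilon> + \<delta>) / 2 < \<epsilon>" using \<delta>(1) by simp
      ultimately show ?thesis using h(1) by blast
    qed
    then show "\<exists>B \<eta>. bounded_in E B \<and> 0 < \<eta> \<and> {h \<in> dual E. \<forall>b\<in>B. norm (h b - g b) \<le> \<eta>} \<subseteq> ?W"
      using B \<delta>(1) by (intro exI[of _ B] exI[of _ "(\<epsilon> - \<delta>) / 2"]) auto
  qed blast
  moreover have "(\<lambda>x. 0) \<in> ?W" using zero \<epsilon> by (auto intro!: exI[of _ 0])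
  ultimately have "eventually (\<lambda>n. f n \<in> ?W) sequentially"
    using lim unfolding limitin_def by blast
  then show "\<forall>\<^sub>F n in sequentially. \<forall>b\<in>B. norm (f n b) \<le> \<epsilon>"
  proof eventually_elim
    case (elim n)
    then obtain \<delta> where "\<delta> < \<epsilon>" "\<forall>b\<in>B. norm (f n b) \<le> \<delta>" by blast
    then show ?case by (meson less_imp_le order_trans)
  qed
next
  assume *: "\<forall>B \<epsilon>. bounded_in E B \<longrightarrow> 0 < \<epsilon> \<longrightarrow> (\<forall>\<^sub>F n in sequentially. \<forall>b\<in>B. norm (f n b) \<le> \<epsilon>)"
  show "limitin (strong_topology E) f (\<lambda>x. 0) sequentially"
    unfolding limitin_def topspace_strong_topology
  proof (intro conjI allI impI zero)
    fix W assume W: "openin (strong_topology E) W \<and> (\<lambda>x. 0) \<in> W"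
    then have "\<forall>f\<in>W. \<exists>B \<epsilon>. bounded_in E B \<and> 0 < \<epsilon> \<and>
        {g \<in> dual E. \<forall>b\<in>B. norm (g b - f b) \<le> \<epsilon>} \<subseteq> W"
      by (simp add: openin_strong_topology)
    from bspec[OF this, of "\<lambda>x. 0"] W obtain B \<epsilon> where
      B: "bounded_in E B" "0 < \<epsilon>" "{g \<in> dual E. \<forall>b\<in>B. norm (g b - 0) \<le> \<epsilon>} \<subseteq> W"
      by auto
    have "\<forall>\<^sub>F n in sequentially. \<forall>b\<in>B. norm (f n b) \<le> \<epsilon>"
      using *[THEN spec, THEN spec, THEN mp, THEN mp, OF B(1,2)] .
    then show "\<forall>\<^sub>F n in sequentially. f n \<in> W"
    proof eventually_elim
      case (elim n)
      then have "f n \<in> {g \<in> dual E. \<forall>b\<in>B. norm (g b - 0) \<le> \<epsilon>}" using f by simp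
      then show ?case using B(3) by (rule subsetD[rotated])
    qed
  qed
qed

section \<open>Boundedness of p-V* sets\<close>

lemma SUP_norm_tendsto_zero_iff:
  fixes \<phi> :: "nat \<Rightarrow> 'a \<Rightarrow> 'b::real_normed_vector"
  assumes A: "A \<noteq> {}"
  shows "(\<lambda>n. SUP a\<in>A. ereal (norm (\<phi> n a))) \<longlonglongrightarrow> 0 \<longleftrightarrow>
    (\<forall>\<epsilon>>0. \<forall>\<^sub>F n in sequentially. \<forall>a\<in>A. norm (\<phi> n a) \<le> \<epsilon>)"
proof (intro iffI allI impI)
  fix \<epsilon> :: real
  assume lim: "(\<lambda>n. SUP a\<in>A. ereal (norm (\<phi> n a))) \<longlonglongrightarrow> 0" and \<epsilon>: "0 < \<epsilon>"
  have "\<forall>\<^sub>F n in sequentially. (SUP a\<in>A. ereal (norm (\<phi> n a))) < ereal \<epsilon>"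
    using order_tendstoD(2)[OF lim, of "ereal \<epsilon>"] \<epsilon> by simp
  then show "\<forall>\<^sub>F n in sequentially. \<forall>a\<in>A. norm (\<phi> n a) \<le> \<epsilon>"
  proof eventually_elim
    case (elim n)
    show ?case
    proof
      fix a assume "a \<in> A"
      then have "ereal (norm (\<phi> n a)) \<le> (SUP a\<in>A. ereal (norm (\<phi> n a)))" by (rule SUP_upper)
      also note elim
      finally show "norm (\<phi> n a) \<le> \<epsilon>" by simp
    qed
  qed
next
  assume *: "\<forall>\<epsilon>>0. \<forall>\<^sub>F n in sequentially. \<forall>a\<in>A. norm (\<phi> n a) \<le> \<epsilon>"
  show "(\<lambda>n. SUP a\<in>A. ereal (norm (\<phi> n a))) \<longlonglongrightarrow> 0"
  proof (rule order_tendstoI)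
    fix c :: ereal assume c: "c < 0"
    obtain a where a: "a \<in> A" using A by blast
    have "c < (SUP a\<in>A. ereal (norm (\<phi> n a)))" for n
    proof -
      have "0 \<le> ereal (norm (\<phi> n a))" by simp
      also have "\<dots> \<le> (SUP a\<in>A. ereal (norm (\<phi> n a)))" using a by (rule SUP_upper)
      finally show ?thesis using c by simp
    qed
    then show "\<forall>\<^sub>F n in sequentially. c < (SUP a\<in>A. ereal (norm (\<phi> n a)))" by simp
  next
    fix c :: ereal assume "0 < c"
    then obtain \<epsilon> where \<epsilon>: "0 < ereal \<epsilon>" "ereal \<epsilon> < c" using ereal_dense2 by blast
    then have "\<forall>\<^sub>F n in sequentially. \<forall>a\<in>A. norm (\<phi> n a) \<le> \<epsilon>" using * by simp
    then show "\<forall>\<^sub>F n in sequentially. (SUP a\<in>A. ereal (norm (\<phi> n a))) < c"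
    proof eventually_elim
      case (elim n)
      then have "(SUP a\<in>A. ereal (norm (\<phi> n a))) \<le> ereal \<epsilon>" by (intro SUP_least) simp
      then show ?case using \<epsilon>(2) by (rule le_less_trans)
    qed
  qed
qed

lemma p_Vstar_setD:
  assumes "p_Vstar_set p E A" "weakly_p_summable p (strong_dual E) \<phi>" "0 < \<epsilon>"
  shows "\<forall>\<^sub>F n in sequentially. \<forall>a\<in>A. norm (\<phi> n a) \<le> \<epsilon>"
proof -
  have ne: "A \<noteq> {}" and lim: "(\<lambda>n. SUP a\<in>A. ereal (norm (\<phi> n a))) \<longlonglongrightarrow> 0"
    using assms(1,2) by (simp_all add: p_Vstar_set_def)
  show ?thesis using iffD1[OF SUP_norm_tendsto_zero_iff[OF ne] lim] assms(3) by simp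
qed

text \<open>
This is what makes the multiples \<open>(1/2) ^ n \<cdot> \<phi>\<close> of one functional a weakly p-summable sequence.
\<close>

lemma p_small_geometric:
  fixes k :: "'k::real_or_complex"
  assumes p: "1 \<le> p"
  shows "p_small p (\<lambda>n. of_real ((1/2) ^ n) * k)"
proof (cases "p = \<infinity>")
  case True
  have "(\<lambda>n. of_real ((1/2) ^ n) * k) \<longlonglongrightarrow> of_real 0 * k"
    by (intro tendsto_intros LIMSEQ_power_zero) simp
  then show ?thesis using True by (simp add: p_small_def)
next
  case False
  then obtain r where r: "p = ereal r" "1 \<le> r" using p by (cases p) auto
  have "norm (of_real ((1/2) ^ n) * k) powr r = norm k powr r * ((1/2) powr r) ^ n" for n
  proof -
    have "((1/2::real) ^ n) powr r = ((1/2) powr r) ^ n"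
      by (simp add: powr_power powr_powr powr_realpow[symmetric] mult.commute)
    then show ?thesis by (simp add: norm_mult norm_power norm_divide powr_mult mult.commute)
  qed
  moreover have "(1/2::real) powr r \<le> (1/2) powr 1"
    using r(2) by (intro powr_mono') auto
  ultimately show ?thesis
    using False r by (simp add: p_small_def summable_mult summable_geometric)
qed

text \<open>
The sequence \<open>(1/2) ^ n \<cdot> \<phi>\<close> is weakly p-summable, so some term is bounded by 1 on \<open>A\<close>; thus \<open>\<phi>\<close> is
bounded on \<open>A\<close>, and weak boundedness implies boundedness.
\<close>

lemma (in lcs) seminorm_bounded_if_p_Vstar_set:
  assumes p: "1 \<le> p" and A: "p_Vstar_set p E A" and q: "cont_seminorm q"
  shows "\<exists>M. \<forall>a\<in>A. q a \<le> M"
proof (rule seminorm_bounded_if_weakly_bounded[OF _ _ q])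
  show "A \<subseteq> carrier E" using A by (simp add: p_Vstar_set_def)
  fix \<phi> assume \<phi>: "\<phi> \<in> dual E"
  define \<psi> where "\<psi> n = (\<lambda>x. of_real ((1/2) ^ n) * \<phi> x)" for n :: nat
  have "weakly_p_summable p (strong_dual E) \<psi>"
    unfolding weakly_p_summable_def
  proof (intro conjI ballI)
    show "range \<psi> \<subseteq> carrier (strong_dual E)" using smult_in_dual[OF \<phi>] by (auto simp: \<psi>_def)
    fix \<Phi> assume "\<Phi> \<in> dual (strong_dual E)"
    then have "\<Phi> (\<psi> n) = of_real ((1/2) ^ n) * \<Phi> \<phi>" for n
      using \<phi> unfolding dual_def[of "strong_dual E"] operator_def linear_map_on_def \<psi>_def by simp
    then show "p_small p (\<lambda>n. \<Phi> (\<psi> n))" using p_small_geometric[OF p] by simp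
  qed
  then obtain n where "\<forall>a\<in>A. norm (\<psi> n a) \<le> 1"
    using p_Vstar_setD[OF A, of \<psi> 1] by (auto simp: eventually_sequentially)
  then have "\<forall>a\<in>A. norm (\<phi> a) \<le> 2 ^ n"
    by (simp add: \<psi>_def norm_mult norm_power norm_divide power_one_over field_simps)
  then show "\<exists>M. \<forall>a\<in>A. norm (\<phi> a) \<le> M" by blast
qed

section \<open>Normed spaces\<close>

locale normed = vec Y for Y :: "('k::real_or_complex, 'y) tvs" (structure) +
  fixes N :: "'y \<Rightarrow> real"
  assumes norm: "norm_on Y N" and topo: "topo Y = norm_topology Y N"

lemma normed_spaceE:
  assumes "normed_space Y"
  obtains N where "normed Y N"
  using assms by (auto simp: normed_space_def normed_def normed_axioms_def vec_def)

lemma (in normed) normed_space: "normed_space Y"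
  using vec norm topo by (auto simp: normed_space_def)

context normed
begin

lemma seminorm_norm: "seminorm N"
  using norm by (simp add: norm_on_def seminorm_def)

lemma openin_topo_iff:
  "openin (topo Y) U \<longleftrightarrow> U \<subseteq> carrier Y \<and>
    (\<forall>x\<in>U. \<exists>r>0. \<forall>y\<in>carrier Y. N (y \<ominus> x) < r \<longrightarrow> y \<in> U)"
proof -
  interpret Metric_space "carrier Y" "\<lambda>x y. if x \<in> carrier Y \<and> y \<in> carrier Y then N (x \<ominus> y) else 0"
  proof
    fix x y z
    show "0 \<le> (if x \<in> carrier Y \<and> y \<in> carrier Y then N (x \<ominus> y) else 0)"
      using seminorm_nonneg[OF seminorm_norm] by simp
    show "(if x \<in> carrier Y \<and> y \<in> carrier Y then N (x \<ominus> y) else 0) =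
        (if y \<in> carrier Y \<and> x \<in> carrier Y then N (y \<ominus> x) else 0)"
      using seminorm_diff_commute[OF seminorm_norm] by simp
    assume x: "x \<in> carrier Y" and y: "y \<in> carrier Y"
    have "x \<ominus> y = \<zero> \<longleftrightarrow> x = y"
      using x y by (metis M.M.l_zero add_diff_cancel(1) diff_self)
    then show "(if x \<in> carrier Y \<and> y \<in> carrier Y then N (x \<ominus> y) else 0) = 0 \<longleftrightarrow> x = y"
      using norm x y by (simp add: norm_on_def)
    assume z: "z \<in> carrier Y"
    show "(if x \<in> carrier Y \<and> z \<in> carrier Y then N (x \<ominus> z) else 0) \<le>
        (if x \<in> carrier Y \<and> y \<in> carrier Y then N (x \<ominus> y) else 0) +
        (if y \<in> carrier Y \<and> z \<in> carrier Y then N (y \<ominus> z) else 0)"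
      using seminorm_diff_triangle[OF seminorm_norm x y z] x y z by simp
  qed
  have mball: "mball x r \<subseteq> U \<longleftrightarrow> (\<forall>y\<in>carrier Y. N (y \<ominus> x) < r \<longrightarrow> y \<in> U)"
    if "x \<in> carrier Y" for x r
    using that seminorm_diff_commute[OF seminorm_norm that] by (auto simp: subset_iff)
  show ?thesis
    unfolding topo norm_topology_def openin_mtopology
  proof (rule conj_cong[OF refl])
    assume U: "U \<subseteq> carrier Y"
    have "(\<exists>r>0. mball x r \<subseteq> U) \<longleftrightarrow> (\<exists>r>0. \<forall>y\<in>carrier Y. N (y \<ominus> x) < r \<longrightarrow> y \<in> U)"
      if "x \<in> U" for x
    proof -
      have "x \<in> carrier Y" using U that by blast
      then show ?thesis by (simp only: mball)
    qed
    then show "(\<forall>x. x \<in> U \<longrightarrow> (\<exists>r>0. mball x r \<subseteq> U)) \<longleftrightarrow>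
        (\<forall>x\<in>U. \<exists>r>0. \<forall>y\<in>carrier Y. N (y \<ominus> x) < r \<longrightarrow> y \<in> U)"
      by (simp add: Ball_def)
  qed
qed

lemma topspace_topo: "topspace (topo Y) = carrier Y"
proof -
  have "openin (topo Y) (carrier Y)"
    unfolding openin_topo_iff by (auto intro: exI[of _ 1])
  then show ?thesis
    using openin_topo_iff[of "topspace (topo Y)"] openin_subset by blast
qed

lemma openin_ball: "a \<in> carrier Y \<Longrightarrow> openin (topo Y) {y \<in> carrier Y. N (y \<ominus> a) < r}"
  unfolding openin_topo_iff
proof (intro conjI ballI)
  fix x assume a: "a \<in> carrier Y" and "x \<in> {y \<in> carrier Y. N (y \<ominus> a) < r}"
  then have x: "x \<in> carrier Y" "N (x \<ominus> a) < r" by auto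
  have "N (y \<ominus> a) < r" if "y \<in> carrier Y" "N (y \<ominus> x) < r - N (x \<ominus> a)" for y
    using seminorm_diff_triangle[OF seminorm_norm that(1) x(1) a] that(2) by simp
  then show "\<exists>e>0. \<forall>y\<in>carrier Y. N (y \<ominus> x) < e \<longrightarrow> y \<in> {y \<in> carrier Y. N (y \<ominus> a) < r}"
    using x by (intro exI[of _ "r - N (x \<ominus> a)"]) auto
qed blast

lemma zero_nbhd_ball:
  assumes "0 < r" shows "zero_nbhd Y {y \<in> carrier Y. N y < r}"
proof -
  have "openin (topo Y) {y \<in> carrier Y. N y < r}"
    using openin_ball[of \<zero> r] by (simp cong: conj_cong)
  then show ?thesis
    using assms seminorm_zero[OF seminorm_norm]
    by (auto simp: zero_nbhd_def interior_of_openin)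
qed

lemma zero_nbhd_contains_ball:
  assumes "zero_nbhd Y U"
  obtains r where "0 < r" "\<And>y. y \<in> carrier Y \<Longrightarrow> N y < r \<Longrightarrow> y \<in> U"
proof -
  have "openin (topo Y) (topo Y interior_of U)" by simp
  then obtain r where "r > 0" "\<forall>y\<in>carrier Y. N (y \<ominus> \<zero>) < r \<longrightarrow> y \<in> topo Y interior_of U"
    using assms unfolding openin_topo_iff zero_nbhd_def by blast
  then show ?thesis using that interior_of_subset[of "topo Y" U] by auto
qed

lemma bounded_in_iff: "bounded_in Y B \<longleftrightarrow> B \<subseteq> carrier Y \<and> (\<exists>M. \<forall>b\<in>B. N b \<le> M)"
proof (intro iffI conjI)
  assume B: "bounded_in Y B"
  then show sub: "B \<subseteq> carrier Y" by (simp add: bounded_in_def)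
  obtain r where r: "r > 0" "\<And>c. norm c \<ge> r \<Longrightarrow> B \<subseteq> (\<lambda>x. c \<odot> x) ` {y \<in> carrier Y. N y < 1}"
    using B zero_nbhd_ball[of 1] unfolding bounded_in_def by auto
  have "N b \<le> r" if b: "b \<in> B" for b
  proof -
    obtain y where "y \<in> carrier Y" "N y < 1" "b = of_real r \<odot> y"
      using r(1) r(2)[of "of_real r"] b by auto
    then show ?thesis using r(1) seminorm_smult[OF seminorm_norm, of y "of_real r"] by simp
  qed
  then show "\<exists>M. \<forall>b\<in>B. N b \<le> M" by blast
next
  assume "B \<subseteq> carrier Y \<and> (\<exists>M. \<forall>b\<in>B. N b \<le> M)"
  then obtain M where B: "B \<subseteq> carrier Y" "\<And>b. b \<in> B \<Longrightarrow> N b \<le> M" by blast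
  show "bounded_in Y B"
    unfolding bounded_in_def
  proof (intro conjI allI impI B(1))
    fix U assume "zero_nbhd Y U"
    then obtain r where r: "0 < r" "\<And>y. y \<in> carrier Y \<Longrightarrow> N y < r \<Longrightarrow> y \<in> U"
      using zero_nbhd_contains_ball by blast
    show "\<exists>s>0. \<forall>c. s \<le> norm c \<longrightarrow> B \<subseteq> (\<lambda>x. c \<odot> x) ` U"
    proof (intro exI[of _ "(\<bar>M\<bar> + 1) / r"] conjI allI impI subsetI)
      show "0 < (\<bar>M\<bar> + 1) / r" using r(1) by simp
      fix c :: 'k and b assume c: "(\<bar>M\<bar> + 1) / r \<le> norm c" and b: "b \<in> B"
      have bc: "b \<in> carrier Y" using B(1) b by blast
      have "0 < (\<bar>M\<bar> + 1) / r" using r(1) by simp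
      then have pos: "0 < norm c" using c by linarith
      have "N b < \<bar>M\<bar> + 1" using B(2)[OF b] by linarith
      also have "\<dots> \<le> norm c * r" using c r(1) by (simp add: divide_le_eq)
      finally have "N (inverse c \<odot> b) < r"
        using pos seminorm_smult[OF seminorm_norm bc, of "inverse c"]
        by (simp add: nonzero_norm_inverse inverse_eq_divide[of "norm c"] divide_less_eq mult.commute)
      then have "inverse c \<odot> b \<in> U" using r(2) bc by simp
      moreover have "b = c \<odot> (inverse c \<odot> b)" using pos bc by simp
      ultimately show "b \<in> (\<lambda>x. c \<odot> x) ` U" by blast
    qed
  qed
qed

end

lemma (in lcs) operator_from_normedI:
  fixes Y :: "('k, 'y) tvs"
  assumes "normed Y N" and T: "linear_map_on Y E T"
    and bound: "\<And>q. cont_seminorm q \<Longrightarrow> \<exists>C. \<forall>y\<in>carrier Y. q (T y) \<le> C * N y"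
  shows "operator Y E T"
proof -
  interpret Y: normed Y N by fact
  have T_in: "T y \<in> carrier E" if "y \<in> carrier Y" for y using T that by (auto simp: linear_map_on_def)
  have T_diff: "T (y \<ominus>\<^bsub>Y\<^esub> a) = T y \<ominus> T a" if "y \<in> carrier Y" "a \<in> carrier Y" for y a
    using T that T_in by (simp add: Y.minus_eq minus_eq linear_map_on_def)
  have "continuous_map (topo Y) (topo E) T"
  proof (rule continuous_map_into_lcs)
    show "T y \<in> carrier E" if "y \<in> topspace (topo Y)" for y
      using that T_in by (simp add: Y.topspace_topo)
    fix a q assume "a \<in> topspace (topo Y)" and q: "cont_seminorm q"
    then have a: "a \<in> carrier Y" by (simp add: Y.topspace_topo)
    obtain C where C: "\<And>y. y \<in> carrier Y \<Longrightarrow> q (T y) \<le> C * N y" using bound[OF q] by blast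
    let ?V = "{y \<in> carrier Y. N (y \<ominus>\<^bsub>Y\<^esub> a) < 1 / (\<bar>C\<bar> + 1)}"
    have "q (T y \<ominus> T a) < 1" if y: "y \<in> ?V" for y
    proof -
      have nonneg: "0 \<le> N (y \<ominus>\<^bsub>Y\<^esub> a)" using y a by (intro Y.seminorm_nonneg Y.seminorm_norm) auto
      have "q (T y \<ominus> T a) \<le> C * N (y \<ominus>\<^bsub>Y\<^esub> a)" using C[of "y \<ominus>\<^bsub>Y\<^esub> a"] y a by (simp add: T_diff)
      also have "\<dots> \<le> \<bar>C\<bar> * N (y \<ominus>\<^bsub>Y\<^esub> a)" using nonneg by (intro mult_right_mono) auto
      also have "\<dots> \<le> \<bar>C\<bar> * (1 / (\<bar>C\<bar> + 1))" using y by (intro mult_left_mono) auto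
      also have "\<dots> < 1" by simp
      finally show ?thesis .
    qed
    moreover have "a \<in> ?V"
      using a Y.seminorm_zero[OF Y.seminorm_norm] by simp
    ultimately show "\<exists>V. openin (topo Y) V \<and> a \<in> V \<and> (\<forall>y\<in>V. q (T y \<ominus> T a) < 1)"
      using Y.openin_ball[OF a] by blast
  qed
  then show ?thesis using T by (simp add: operator_def)
qed

lemma (in normed) zero_in_dual: "(\<lambda>y. 0) \<in> dual Y"
  by (simp add: dual_def operator_def linear_map_on_def)

lemma (in normed) adjoint_map_in_dual:
  assumes T: "operator Y E T" and \<phi>: "\<phi> \<in> dual E"
  shows "adjoint_map Y T \<phi> \<in> dual Y"
proof -
  have "continuous_map (topo Y) euclidean (\<phi> \<circ> T)"
    using T \<phi> by (intro continuous_map_compose[of _ "topo E"]) (simp_all add: operator_def dual_def)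
  then have "continuous_map (topo Y) euclidean (adjoint_map Y T \<phi>)"
    by (rule continuous_map_eq) (simp add: adjoint_map_def topspace_topo)
  then show ?thesis
    using T \<phi> by (auto simp: dual_def operator_def linear_map_on_def adjoint_map_def Pi_iff)
qed

section \<open>Operators from normed spaces with p-convergent adjoint\<close>

text \<open>
Strong convergence to zero of the functionals \<open>\<phi> n \<circ> T\<close> is uniform convergence on the unit ball, that is,
uniform convergence of \<open>\<phi> n\<close> on its image.
\<close>

lemma (in normed) p_Vstar_set_image_ball:
  assumes T: "operator Y E T"
    and conv: "p_convergent p (strong_dual E) (strong_dual Y) (adjoint_map Y T)"
  shows "p_Vstar_set p E (T ` {y \<in> carrier Y. N y < 1})"
proof -
  let ?B = "{y \<in> carrier Y. N y < 1}"
  have B: "bounded_in Y ?B" unfolding bounded_in_iff by (auto intro!: exI[of _ 1])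
  have ne: "\<zero> \<in> ?B" using seminorm_zero[OF seminorm_norm] by simp
  show ?thesis
    unfolding p_Vstar_set_def
  proof (intro conjI allI impI)
    show "T ` ?B \<noteq> {}" using ne by blast
    then show "T ` ?B \<subseteq> carrier E" using T by (auto simp: operator_def linear_map_on_def)
    fix \<phi> assume \<phi>: "weakly_p_summable p (strong_dual E) \<phi>"
    then have dual: "\<phi> n \<in> dual E" for n by (auto simp: weakly_p_summable_def)
    have lim: "limitin (strong_topology Y) (\<lambda>n. adjoint_map Y T (\<phi> n)) (\<lambda>y. 0) sequentially"
      using conv \<phi> by (simp add: p_convergent_def)
    have *: "\<forall>\<^sub>F n in sequentially. \<forall>b\<in>?B. norm (adjoint_map Y T (\<phi> n) b) \<le> \<epsilon>"
      if "0 < \<epsilon>" for \<epsilon>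
      using limitin_strong_topology_zero_iff[OF zero_in_dual adjoint_map_in_dual[OF T dual],
          THEN iffD1, OF lim, THEN spec, THEN spec, THEN mp, THEN mp, OF B that] .
    have "\<forall>\<^sub>F n in sequentially. \<forall>a\<in>T ` ?B. norm (\<phi> n a) \<le> \<epsilon>" if "0 < \<epsilon>" for \<epsilon>
      using *[OF that] by eventually_elim (auto simp: adjoint_map_def)
    then have "\<forall>\<epsilon>>0. \<forall>\<^sub>F n in sequentially. \<forall>a\<in>T ` ?B. norm (\<phi> n a) \<le> \<epsilon>" by blast
    then show "(\<lambda>n. SUP a\<in>T ` ?B. ereal (norm (\<phi> n a))) \<longlonglongrightarrow> 0"
      by (rule iffD2[OF SUP_norm_tendsto_zero_iff[OF \<open>T ` ?B \<noteq> {}\<close>]])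
  qed
qed

text \<open>
The domination hypothesis says that \<open>T\<close> maps the unit ball into the bipolar of \<open>A\<close>, so a functional
that is small on \<open>A\<close> is small on the images of all bounded sets.
\<close>

lemma (in normed) p_convergent_adjointI:
  assumes T: "operator Y E T" and A: "p_Vstar_set p E A"
    and dom: "\<And>\<phi> M y. \<phi> \<in> dual E \<Longrightarrow> \<forall>a\<in>A. norm (\<phi> a) \<le> M \<Longrightarrow> y \<in> carrier Y \<Longrightarrow>
      norm (\<phi> (T y)) \<le> M * N y"
  shows "p_convergent p (strong_dual E) (strong_dual Y) (adjoint_map Y T)"
  unfolding p_convergent_def
proof (intro allI impI)
  fix \<phi> assume \<phi>: "weakly_p_summable p (strong_dual E) \<phi>"
  then have dual: "\<phi> n \<in> dual E" for n by (auto simp: weakly_p_summable_def)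
  have "limitin (strong_topology Y) (\<lambda>n. adjoint_map Y T (\<phi> n)) (\<lambda>y. 0) sequentially"
    unfolding limitin_strong_topology_zero_iff[OF zero_in_dual adjoint_map_in_dual[OF T dual]]
  proof (intro allI impI)
    fix B and \<epsilon> :: real assume "bounded_in Y B" and \<epsilon>: "0 < \<epsilon>"
    then obtain M where B: "B \<subseteq> carrier Y" "\<And>b. b \<in> B \<Longrightarrow> N b \<le> M" by (auto simp: bounded_in_iff)
    define \<delta> where "\<delta> = \<epsilon> / (\<bar>M\<bar> + 1)"
    have \<delta>: "0 < \<delta>" using \<epsilon> by (simp add: \<delta>_def)
    have "\<forall>\<^sub>F n in sequentially. \<forall>a\<in>A. norm (\<phi> n a) \<le> \<delta>" using p_Vstar_setD[OF A \<phi> \<delta>] .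
    then show "\<forall>\<^sub>F n in sequentially. \<forall>b\<in>B. norm (adjoint_map Y T (\<phi> n) b) \<le> \<epsilon>"
    proof eventually_elim
      case (elim n)
      show ?case
      proof
        fix b assume b: "b \<in> B"
        then have "norm (\<phi> n (T b)) \<le> \<delta> * N b" using dom[OF dual elim] B(1) by blast
        also have "\<dots> \<le> \<delta> * (\<bar>M\<bar> + 1)" using \<delta> B(2)[OF b] by (intro mult_left_mono) auto
        also have "\<dots> = \<epsilon>" by (simp add: \<delta>_def)
        finally show "norm (adjoint_map Y T (\<phi> n) b) \<le> \<epsilon>"
          using b B(1) by (auto simp: adjoint_map_def)
      qed
    qed
  qed
  then show "limitin (topo (strong_dual Y)) (\<lambda>n. adjoint_map Y T (\<phi> n)) \<zero>\<^bsub>strong_dual Y\<^esub> sequentially"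
    by simp
qed

section \<open>Convergence in locally complete spaces\<close>

text \<open>
Without metrizability a sequence in a compact set may have no convergent subsequence; a cluster
point suffices for Cauchy sequences.
\<close>

lemma compactin_sequence_cluster_point:
  fixes x :: "nat \<Rightarrow> 'b"
  assumes K: "compactin X K" and x: "range x \<subseteq> K"
  obtains y where "y \<in> K" "\<And>U i. openin X U \<Longrightarrow> y \<in> U \<Longrightarrow> \<exists>j\<ge>i. x j \<in> U"
proof -
  define F where "F i = X closure_of (x ` {i..})" for i
  have KX: "K \<subseteq> topspace X" using K by (simp add: compactin_def)
  have "K \<inter> \<Inter>\<F> \<noteq> {}" if \<F>: "finite \<F>" "\<F> \<subseteq> range F" for \<F>
  proof -
    obtain I where I: "finite I" "\<F> = F ` I" using \<F> finite_subset_image by metis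
    have "x (Max (insert 0 I)) \<in> F i" if "i \<in> I" for i
    proof -
      have "x (Max (insert 0 I)) \<in> x ` {i..}" using that I(1) by (intro imageI) simp
      moreover have "x ` {i..} \<subseteq> F i"
        unfolding F_def using x KX by (intro closure_of_subset) auto
      ultimately show ?thesis by blast
    qed
    then have "x (Max (insert 0 I)) \<in> K \<inter> \<Inter>\<F>" using I(2) x by auto
    then show ?thesis by blast
  qed
  moreover have "closedin X C" if "C \<in> range F" for C using that by (auto simp: F_def)
  ultimately have "K \<inter> \<Inter>(range F) \<noteq> {}" using K unfolding compactin_fip by blast
  then obtain y where y: "y \<in> K" "\<And>i. y \<in> F i" by auto
  show ?thesis
  proof (rule that[OF y(1)])
    fix U i assume "openin X U" "y \<in> U"
    then show "\<exists>j\<ge>i. x j \<in> U"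
      using y(2)[of i] unfolding F_def in_closure_of by blast
  qed
qed

context lcs
begin

lemma absolutely_convex_hull_props:
  assumes "A \<subseteq> carrier E"
  defines "H \<equiv> absolutely_convex_hull_in E A"
  shows "A \<subseteq> H" "H \<subseteq> carrier E"
    "\<And>x y a b. x \<in> H \<Longrightarrow> y \<in> H \<Longrightarrow> norm a + norm b \<le> 1 \<Longrightarrow> a \<odot> x \<oplus> b \<odot> y \<in> H"
proof -
  have "absolutely_convex_in E (carrier E)" by (auto simp: absolutely_convex_in_def)
  then show "A \<subseteq> H" "H \<subseteq> carrier E"
    using assms(1) by (auto simp: H_def absolutely_convex_hull_in_def)
  show "a \<odot> x \<oplus> b \<odot> y \<in> H" if "x \<in> H" "y \<in> H" "norm a + norm b \<le> 1" for x y a b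
    using that by (auto simp: H_def absolutely_convex_hull_in_def absolutely_convex_in_def)
qed

lemma seminorm_telescope_le:
  assumes q: "seminorm q" and s: "\<And>n. s n \<in> carrier E"
    and step: "\<And>n. q (s (Suc n) \<ominus> s n) \<le> v n"
  shows "q (s (n + k) \<ominus> s n) \<le> sum v {n..<n + k}"
proof (induction k)
  case 0
  show ?case using s q by (simp add: seminorm_zero)
next
  case (Suc k)
  have "q (s (n + Suc k) \<ominus> s n) \<le> q (s (Suc (n + k)) \<ominus> s (n + k)) + q (s (n + k) \<ominus> s n)"
    using seminorm_diff_triangle[OF q s s s, of "Suc (n + k)" n "n + k"] by simp
  then show ?case using Suc step[of "n + k"] by simp
qed

text \<open>
The increments of \<open>s\<close> are grouped into blocks ending at indices \<open>\<nu> j\<close> such that the \<open>j\<close>-th block is of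
order \<open>(1/4) ^ j\<close> in every continuous seminorm. The blocks multiplied by \<open>2 ^ j\<close> form a null sequence
\<open>z\<close>, and \<open>s (\<nu> j) - s (\<nu> 0)\<close> is the sum of the \<open>z i / 2 ^ i\<close> for \<open>i < j\<close>, hence twice an element of the
absolutely convex hull of \<open>z\<close>. That hull has compact closure, which provides a cluster point, and \<open>s\<close>
is Cauchy.
\<close>

lemma locally_complete_convergent:
  assumes complete: "locally_complete E" and s: "\<And>n. s n \<in> carrier E"
    and u: "summable u" "\<And>n. 0 \<le> u n"
    and step: "\<And>q. cont_seminorm q \<Longrightarrow> \<exists>C. \<forall>n. q (s (Suc n) \<ominus> s n) \<le> C * u n"
  obtains l where "limitin (topo E) s l sequentially"
proof -
  have "\<exists>n. \<forall>m\<ge>n. \<forall>k. sum u {m..<m + k} < (1/4) ^ j" for j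
  proof -
    obtain n where n: "\<And>m k. m \<ge> n \<Longrightarrow> norm (sum u {m..<k}) < (1/4) ^ j"
      using u(1) unfolding summable_Cauchy by (metis zero_less_power zero_less_divide_1_iff zero_less_numeral)
    then show ?thesis by (intro exI[of _ n]) (auto dest: abs_le_D1[OF less_imp_le] intro: le_less_trans[OF abs_ge_self])
  qed
  then obtain \<nu>0 where \<nu>0: "\<And>j m k. m \<ge> \<nu>0 j \<Longrightarrow> sum u {m..<m + k} < (1/4) ^ j" by metis
  \<comment> \<open>summing makes the thresholds monotone\<close>
  define \<nu> where "\<nu> j = (\<Sum>i\<le>j. \<nu>0 i)" for j
  have \<nu>_mono: "\<nu> i \<le> \<nu> j" if "i \<le> j" for i j
    unfolding \<nu>_def using that by (intro sum_mono2) auto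
  have \<nu>_ge: "\<nu>0 j \<le> \<nu> j" for j unfolding \<nu>_def by (intro member_le_sum) auto
  have close: "\<exists>C\<ge>0. \<forall>j m n. \<nu> j \<le> m \<longrightarrow> \<nu> j \<le> n \<longrightarrow> q (s m \<ominus> s n) \<le> C * (1/4) ^ j"
    if q: "cont_seminorm q" for q
  proof -
    have sq: "seminorm q" using q by (simp add: cont_seminorm_def)
    obtain C where C: "\<And>n. q (s (Suc n) \<ominus> s n) \<le> C * u n" using step[OF q] by blast
    have C': "q (s (Suc n) \<ominus> s n) \<le> \<bar>C\<bar> * u n" for n
      using C[of n] mult_right_mono[OF abs_ge_self u(2), of C n] by linarith
    have le: "q (s (n + k) \<ominus> s n) \<le> \<bar>C\<bar> * (1/4) ^ j" if "\<nu> j \<le> n" for n k j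
    proof -
      have "q (s (n + k) \<ominus> s n) \<le> (\<Sum>i=n..<n + k. \<bar>C\<bar> * u i)"
        using sq s C' by (rule seminorm_telescope_le[where s = s and v = "\<lambda>i. \<bar>C\<bar> * u i"])
      also have "\<dots> = \<bar>C\<bar> * sum u {n..<n + k}" by (simp add: sum_distrib_left)
      also have "\<dots> \<le> \<bar>C\<bar> * (1/4) ^ j"
        using \<nu>0[of j n k] \<nu>_ge[of j] that by (intro mult_left_mono) auto
      finally show ?thesis .
    qed
    have "q (s m \<ominus> s n) \<le> \<bar>C\<bar> * (1/4) ^ j" if "\<nu> j \<le> m" "\<nu> j \<le> n" for m n j
    proof (cases "n \<le> m")
      case True
      then show ?thesis using le[OF that(2), of "m - n"] by simp
    next
      case False
      then show ?thesis
        using le[OF that(1), of "n - m"] seminorm_diff_commute[OF sq s s, of m n] by simp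
    qed
    then show ?thesis by (intro exI[of _ "\<bar>C\<bar>"]) auto
  qed
  define z where "z j = of_real (2 ^ j) \<odot> (s (\<nu> (Suc j)) \<ominus> s (\<nu> j))" for j
  have z: "range z \<subseteq> carrier E" using s by (auto simp: z_def)
  have "limitin (topo E) z \<zero> sequentially"
    unfolding limitin_iff_seminorms[OF z]
  proof (intro conjI allI impI)
    fix q assume q: "cont_seminorm q"
    then have sq: "seminorm q" by (simp add: cont_seminorm_def)
    obtain C where C: "\<And>j m n. \<nu> j \<le> m \<Longrightarrow> \<nu> j \<le> n \<Longrightarrow> q (s m \<ominus> s n) \<le> C * (1/4) ^ j"
      using close[OF q] by blast
    have le: "norm (q (z j \<ominus> \<zero>)) \<le> C * (1/2) ^ j" for j
    proof -
      have zj: "z j \<in> carrier E" using s by (simp add: z_def)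
      have "q (z j) = 2 ^ j * q (s (\<nu> (Suc j)) \<ominus> s (\<nu> j))"
        using s by (simp add: z_def seminorm_smult[OF sq] norm_power)
      also have "\<dots> \<le> 2 ^ j * (C * (1/4) ^ j)"
        using C[of j "\<nu> (Suc j)" "\<nu> j"] \<nu>_mono[of j "Suc j"] by (intro mult_left_mono) auto
      also have "\<dots> = C * (1/2) ^ j"
      proof -
        have "(2::real) ^ j * (1/4) ^ j = (1/2) ^ j" by (simp flip: power_mult_distrib)
        then show ?thesis by (simp add: mult.left_commute)
      qed
      finally show ?thesis using seminorm_nonneg[OF sq zj] zj by simp
    qed
    have "(\<lambda>j. C * (1/2) ^ j) \<longlonglongrightarrow> 0"
      using tendsto_mult_right_zero[OF LIMSEQ_power_zero[of "1/2::real"]] by simp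
    then show "(\<lambda>j. q (z j \<ominus> \<zero>)) \<longlonglongrightarrow> 0"
      by (rule Lim_null_comparison[OF always_eventually[OF allI[OF le]]])
  qed simp
  define H where "H = absolutely_convex_hull_in E (range z)"
  have H: "range z \<subseteq> H" "H \<subseteq> carrier E"
    "\<And>x y a b. x \<in> H \<Longrightarrow> y \<in> H \<Longrightarrow> norm a + norm b \<le> 1 \<Longrightarrow> a \<odot> x \<oplus> b \<odot> y \<in> H"
    using absolutely_convex_hull_props[OF z] unfolding H_def by blast+
  \<comment> \<open>the first block of the tail from \<open>i\<close> and the tail from \<open>Suc i\<close> get weight \<open>1/2\<close> each, so only binary
    absolutely convex combinations occur; the additional factor \<open>1/2\<close> absorbs the sum of the weights\<close>
  have block: "of_real (2 ^ i / 2) \<odot> (s (\<nu> (i + j)) \<ominus> s (\<nu> i)) \<in> H" for i j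
  proof (induction j arbitrary: i)
    case 0
    have "0 \<odot> z 0 \<oplus> 0 \<odot> z 0 \<in> H" using H(1) by (intro H(3)) auto
    moreover have "z 0 \<in> carrier E" using z by auto
    ultimately show ?case using s by simp
  next
    case (Suc j)
    let ?a = "s (\<nu> i)" and ?b = "s (\<nu> (Suc i))" and ?c = "s (\<nu> (Suc i + j))"
    have "of_real (1/2) \<odot> (of_real (2 ^ Suc i / 2) \<odot> (?c \<ominus> ?b)) \<oplus> of_real (1/2) \<odot> z i \<in> H"
      using Suc[of "Suc i"] H(1) by (intro H(3)) (auto simp: norm_divide)
    moreover have "of_real (1/2) \<odot> (of_real (2 ^ Suc i / 2) \<odot> (?c \<ominus> ?b)) = of_real (2 ^ i / 2) \<odot> (?c \<ominus> ?b)"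
      using s by simp
    moreover have "of_real (1/2) \<odot> z i = of_real (2 ^ i / 2) \<odot> (?b \<ominus> ?a)"
      using s by (simp add: z_def)
    moreover have "of_real (2 ^ i / 2) \<odot> (?c \<ominus> ?b) \<oplus> of_real (2 ^ i / 2) \<odot> (?b \<ominus> ?a) =
        of_real (2 ^ i / 2) \<odot> (?c \<ominus> ?a)"
      using s by (simp only: smult_add_right[symmetric] diff_add_diff closed)
    ultimately show ?case by simp
  qed
  define x where "x j = of_real (1/2) \<odot> (s (\<nu> j) \<ominus> s (\<nu> 0))" for j
  have x: "x j \<in> carrier E" for j using s by (simp add: x_def)
  define K where "K = topo E closure_of H"
  have "compactin (topo E) K"
    using complete z \<open>limitin (topo E) z \<zero> sequentially\<close> unfolding locally_complete_def K_def H_def by blast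
  moreover have "range x \<subseteq> K"
  proof -
    have "range x \<subseteq> H" using block[of 0] by (auto simp: x_def)
    also have "H \<subseteq> K" unfolding K_def using H(2) by (intro closure_of_subset) simp
    finally show ?thesis .
  qed
  ultimately obtain y where y: "y \<in> K" "\<And>U i. openin (topo E) U \<Longrightarrow> y \<in> U \<Longrightarrow> \<exists>j\<ge>i. x j \<in> U"
    using compactin_sequence_cluster_point by blast
  have yE: "y \<in> carrier E" using y(1) closure_of_subset_topspace[of "topo E" H] by (auto simp: K_def)
  define l where "l = of_real 2 \<odot> y \<oplus> s (\<nu> 0)"
  have lE: "l \<in> carrier E" using yE s by (simp add: l_def)
  have "limitin (topo E) s l sequentially"
  proof (subst limitin_iff_seminorms)
    show "range s \<subseteq> carrier E" using s by blast
    show "l \<in> carrier E \<and> (\<forall>q. cont_seminorm q \<longrightarrow> (\<lambda>n. q (s n \<ominus> l)) \<longlonglongrightarrow> 0)"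
    proof (intro conjI allI impI lE)
      fix q assume q: "cont_seminorm q"
      then have sq: "seminorm q" by (simp add: cont_seminorm_def)
      obtain C where C: "0 \<le> C" "\<And>j m n. \<nu> j \<le> m \<Longrightarrow> \<nu> j \<le> n \<Longrightarrow> q (s m \<ominus> s n) \<le> C * (1/4) ^ j"
        using close[OF q] by blast
      show "(\<lambda>n. q (s n \<ominus> l)) \<longlonglongrightarrow> 0"
      proof (rule LIMSEQ_I)
        fix e :: real assume e: "0 < e"
        obtain J where "(1/4::real) ^ J < e / (2 * (C + 1))"
          using real_arch_pow_inv[of "e / (2 * (C + 1))" "1/4"] e C(1) by auto
        then have "(C + 1) * (1/4) ^ J < e / 2" using C(1) by (simp add: field_simps)
        moreover have "C * (1/4) ^ J \<le> (C + 1) * (1/4) ^ J" by (intro mult_right_mono) auto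
        ultimately have CJ: "C * (1/4) ^ J < e / 2" by linarith
        obtain U where U: "openin (topo E) U" "y \<in> U" "\<And>x. x \<in> U \<Longrightarrow> q (x \<ominus> y) < e / 4"
          using cont_seminorm_ball[OF q yE, of "e / 4"] e by auto
        obtain i where i: "i \<ge> J" "x i \<in> U" using y(2)[OF U(1,2)] by blast
        have "s (\<nu> i) = of_real 2 \<odot> x i \<oplus> s (\<nu> 0)" using s by (simp add: x_def)
        then have "s (\<nu> i) \<ominus> l = of_real 2 \<odot> (x i \<ominus> y)"
          using s x yE by (simp add: l_def add_diff_add smult_diff_right minus_eq[of "s (\<nu> 0)"] add_neg)
        then have il: "q (s (\<nu> i) \<ominus> l) < e / 2"
          using U(3)[OF i(2)] seminorm_smult[OF sq, of "x i \<ominus> y" "of_real 2"] x yE by simp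
        show "\<exists>n0. \<forall>n\<ge>n0. norm (q (s n \<ominus> l) - 0) < e"
        proof (intro exI[of _ "\<nu> J"] allI impI)
          fix n assume "\<nu> J \<le> n"
          then have "q (s n \<ominus> s (\<nu> i)) < e / 2"
            using C(2)[of J n "\<nu> i"] \<nu>_mono[OF i(1)] CJ by linarith
          then have "q (s n \<ominus> l) < e"
            using il seminorm_diff_triangle[OF sq s s lE, of n "\<nu> i"] by simp
          then show "norm (q (s n \<ominus> l) - 0) < e"
            using seminorm_nonneg[OF sq, of "s n \<ominus> l"] s lE by simp
        qed
      qed
    qed
  qed
  then show ?thesis by (rule that)
qed

end

section \<open>Series with summable coefficients\<close>

primrec partial_sum :: "('k::real_or_complex, 'a) tvs \<Rightarrow> (nat \<Rightarrow> 'a) \<Rightarrow> (nat \<Rightarrow> 'k) \<Rightarrow> nat \<Rightarrow> 'a" where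
  "partial_sum E x c 0 = \<zero>\<^bsub>E\<^esub>"
| "partial_sum E x c (Suc n) = partial_sum E x c n \<oplus>\<^bsub>E\<^esub> c n \<odot>\<^bsub>E\<^esub> x n"

context lcs
begin

lemma partial_sum_closed:
  assumes "\<And>n. x n \<in> carrier E"
  shows "partial_sum E x c n \<in> carrier E"
  using assms by (induction n) simp_all

lemma partial_sum_add:
  assumes "\<And>n. x n \<in> carrier E"
  shows "partial_sum E x (\<lambda>n. c n + d n) n = partial_sum E x c n \<oplus> partial_sum E x d n"
  using assms by (induction n) (simp_all add: smult_add_left add_add_swap partial_sum_closed)

lemma partial_sum_smult:
  assumes "\<And>n. x n \<in> carrier E"
  shows "partial_sum E x (\<lambda>n. a * c n) n = a \<odot> partial_sum E x c n"
  using assms by (induction n) (simp_all add: smult_add_right partial_sum_closed)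

lemma limitin_eventually_const:
  assumes "\<And>n. s n \<in> carrier E" "\<And>n. n \<ge> m \<Longrightarrow> s n = l"
  shows "limitin (topo E) s l sequentially"
proof -
  have "l \<in> carrier E" using assms(1)[of m] assms(2)[of m] by simp
  moreover have "\<forall>\<^sub>F n in sequentially. s n = l"
    using assms(2) by (auto simp: eventually_sequentially)
  ultimately show ?thesis
    unfolding limitin_def by (auto elim: eventually_mono)
qed

lemma partial_sum_finite_support:
  assumes x: "\<And>n. x n \<in> carrier E" and c: "\<And>n. n \<ge> m \<Longrightarrow> c n = 0"
  shows "limitin (topo E) (partial_sum E x c) (partial_sum E x c m) sequentially"
proof (rule limitin_eventually_const[where m = m])
  show "partial_sum E x c n \<in> carrier E" for n using x by (rule partial_sum_closed)
  show "partial_sum E x c n = partial_sum E x c m" if "n \<ge> m" for n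
    using that by (induction rule: dec_induct) (simp_all add: c x partial_sum_closed)
qed

lemma partial_sum_unit_vector:
  assumes x: "\<And>n. x n \<in> carrier E"
  shows "partial_sum E x (unit_vector k) (Suc k) = x k"
proof -
  have "partial_sum E x (unit_vector k) n = \<zero>" if "n \<le> k" for n
    using that by (induction n) (simp_all add: unit_vector_def x)
  then show ?thesis by (simp add: unit_vector_def x)
qed

lemma locally_complete_series_convergent:
  assumes complete: "locally_complete E" and x: "\<And>n. x n \<in> carrier E"
    and bounded: "\<And>q. cont_seminorm q \<Longrightarrow> \<exists>M. \<forall>n. q (x n) \<le> M"
    and c: "summable (\<lambda>n. norm (c n))"
  obtains l where "limitin (topo E) (partial_sum E x c) l sequentially"
proof (rule locally_complete_convergent[OF complete _ c])
  show "partial_sum E x c n \<in> carrier E" for n using x by (rule partial_sum_closed)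
  fix q assume q: "cont_seminorm q"
  then have sq: "seminorm q" by (simp add: cont_seminorm_def)
  obtain M where M: "\<And>n. q (x n) \<le> M" using bounded[OF q] by blast
  have "q (partial_sum E x c (Suc n) \<ominus> partial_sum E x c n) \<le> M * norm (c n)" for n
  proof -
    have "partial_sum E x c (Suc n) \<ominus> partial_sum E x c n = c n \<odot> x n"
      using add_diff_cancel(2)[of "c n \<odot> x n" "partial_sum E x c n"] x
      by (simp add: partial_sum_closed M.M.a_comm)
    then show ?thesis
      using M[of n] by (simp add: seminorm_smult[OF sq x] mult.commute[of M] mult_left_mono)
  qed
  then show "\<exists>C. \<forall>n. q (partial_sum E x c (Suc n) \<ominus> partial_sum E x c n) \<le> C * norm (c n)" by blast
qed (use that in auto)

lemma limitin_unique:
  "limitin (topo E) s l sequentially \<Longrightarrow> limitin (topo E) s l' sequentially \<Longrightarrow> l = l'"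
  using lc by (intro limitin_Hausdorff_unique[of "topo E" s l sequentially l'])
    (simp_all add: locally_convex_space_def)

lemma limitin_add:
  assumes "limitin (topo E) s l F" "limitin (topo E) t m F"
  shows "limitin (topo E) (\<lambda>n. s n \<oplus> t n) (l \<oplus> m) F"
proof -
  have "continuous_map (prod_topology (topo E) (topo E)) (topo E) (\<lambda>(x, y). x \<oplus> y)"
    using lc by (simp add: locally_convex_space_def)
  from continuous_map_limit[OF this, of "\<lambda>n. (s n, t n)" "(l, m)" F] show ?thesis
    using assms by (simp add: limitin_pairwise o_def)
qed

lemma limitin_smult:
  assumes "limitin (topo E) s l F"
  shows "limitin (topo E) (\<lambda>n. c \<odot> s n) (c \<odot> l) F"
proof -
  have "continuous_map (topo E) (topo E) (\<lambda>x. c \<odot> x)"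
    by (intro continuous_map_smult) auto
  from continuous_map_limit[OF this assms] show ?thesis by (simp add: o_def)
qed

lemma seminorm_series_le:
  assumes q: "cont_seminorm q" and x: "\<And>n. x n \<in> carrier E" and M: "\<And>n. q (x n) \<le> M"
    and c: "summable (\<lambda>n. norm (c n))"
    and lim: "limitin (topo E) (partial_sum E x c) l sequentially"
  shows "q l \<le> M * l1_norm c"
proof -
  have sq: "seminorm q" using q by (simp add: cont_seminorm_def)
  have M0: "0 \<le> M" using M[of 0] seminorm_nonneg[OF sq x[of 0]] by simp
  have l: "l \<in> carrier E" using lim by (simp add: limitin_def)
  have ps: "partial_sum E x c n \<in> carrier E" for n using x by (rule partial_sum_closed)
  have part: "q (partial_sum E x c n) \<le> M * (\<Sum>k<n. norm (c k))" for n
  proof (induction n)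
    case 0 then show ?case by (simp add: seminorm_zero[OF sq])
  next
    case (Suc n)
    have "q (partial_sum E x c (Suc n)) \<le> q (partial_sum E x c n) + norm (c n) * q (x n)"
      using seminorm_add[OF sq ps[of n], of "c n \<odot> x n"] x by (simp add: seminorm_smult[OF sq])
    also have "\<dots> \<le> M * (\<Sum>k<n. norm (c k)) + norm (c n) * M"
      using Suc M[of n] by (intro add_mono mult_left_mono) auto
    finally show ?case by (simp add: algebra_simps)
  qed
  have "q l \<le> M * l1_norm c + q (partial_sum E x c n \<ominus> l)" for n
  proof -
    have "l = partial_sum E x c n \<ominus> (partial_sum E x c n \<ominus> l)"
      using l ps[of n] by (simp add: minus_eq smult_add_right M.M.a_assoc[symmetric] add_neg)
    then have "q l \<le> q (partial_sum E x c n) + q (partial_sum E x c n \<ominus> l)"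
      using seminorm_diff[OF sq ps[of n], of "partial_sum E x c n \<ominus> l"] l ps by (metis closed(2))
    moreover have "M * (\<Sum>k<n. norm (c k)) \<le> M * l1_norm c"
      unfolding l1_norm_def using M0 c by (intro mult_left_mono sum_le_suminf) auto
    ultimately show ?thesis using part[of n] by linarith
  qed
  moreover have "(\<lambda>n. M * l1_norm c + q (partial_sum E x c n \<ominus> l)) \<longlonglongrightarrow> M * l1_norm c + 0"
    using lim q ps by (intro tendsto_add tendsto_const) (auto simp: limitin_iff_seminorms image_subset_iff)
  ultimately show ?thesis by (intro LIMSEQ_le_const[of _ _ "q l"]) auto
qed

end

section \<open>Sequence spaces inside l1\<close>

text \<open>
The space of the sequences in \<open>S\<close> with the norm of \<open>l1\<close>, carried over to another type along an
injection \<open>j\<close>.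
\<close>

definition seq_space :: "((nat \<Rightarrow> 'k::real_or_complex) \<Rightarrow> 'y) \<Rightarrow> (nat \<Rightarrow> 'k) set \<Rightarrow> ('k, 'y) tvs" where
  "seq_space j S = (let V = \<lparr>carrier = j ` S, mult = undefined, one = undefined,
       zero = j (\<lambda>n. 0), add = (\<lambda>u v. j (\<lambda>n. the_inv j u n + the_inv j v n)),
       smult = (\<lambda>c u. j (\<lambda>n. c * the_inv j u n)), topo = undefined\<rparr>
     in V\<lparr>topo := norm_topology V (\<lambda>u. l1_norm (the_inv j u))\<rparr>)"

lemma norm_topology_cong:
  fixes V W :: "('k::real_or_complex, 'a) tvs"
  assumes "carrier V = carrier W" "add V = add W" "zero V = zero W"
  shows "norm_topology V N = norm_topology W N"
proof -
  have "a_inv V = a_inv W" by (simp add: a_inv_def assms)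
  then have eq: "a_minus V = a_minus W"
    by (intro ext) (simp add: a_minus_def assms)
  show ?thesis unfolding norm_topology_def eq assms(1) by (rule refl)
qed

lemma seq_space_simps [simp]:
  "carrier (seq_space j S) = j ` S" "zero (seq_space j S) = j (\<lambda>n. 0)"
  "add (seq_space j S) = (\<lambda>u v. j (\<lambda>n. the_inv j u n + the_inv j v n))"
  "smult (seq_space j S) = (\<lambda>c u. j (\<lambda>n. c * the_inv j u n))"
  by (simp_all add: seq_space_def Let_def)

lemma topo_seq_space: "topo (seq_space j S) = norm_topology (seq_space j S) (\<lambda>u. l1_norm (the_inv j u))"
proof -
  have "topo (seq_space j S) = norm_topology \<lparr>carrier = j ` S, mult = undefined, one = undefined,
       zero = j (\<lambda>n. 0), add = (\<lambda>u v. j (\<lambda>n. the_inv j u n + the_inv j v n)),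
       smult = (\<lambda>c u. j (\<lambda>n. c * the_inv j u n)), topo = undefined\<rparr> (\<lambda>u. l1_norm (the_inv j u))"
    by (simp add: seq_space_def Let_def)
  also have "\<dots> = norm_topology (seq_space j S) (\<lambda>u. l1_norm (the_inv j u))"
    by (rule norm_topology_cong) simp_all
  finally show ?thesis .
qed

locale seq_copy =
  fixes j :: "(nat \<Rightarrow> 'k::real_or_complex) \<Rightarrow> 'y" and S :: "(nat \<Rightarrow> 'k) set"
  assumes inj: "inj j"
    and summable: "\<And>c. c \<in> S \<Longrightarrow> summable (\<lambda>n. norm (c n))"
    and add: "\<And>c d. c \<in> S \<Longrightarrow> d \<in> S \<Longrightarrow> (\<lambda>n. c n + d n) \<in> S"
    and smult: "\<And>a c. c \<in> S \<Longrightarrow> (\<lambda>n. a * c n) \<in> S"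
    and unit: "\<And>k. unit_vector k \<in> S"
begin

lemma the_inv_j [simp]: "the_inv j (j c) = c"
  using inj by (rule the_inv_f_f)

lemma zero: "(\<lambda>n. 0) \<in> S"
  using smult[OF unit, of 0 0] by simp

lemma l1_norm_add:
  assumes "c \<in> S" "d \<in> S" shows "l1_norm (\<lambda>n. c n + d n) \<le> l1_norm c + l1_norm d"
proof -
  have "l1_norm (\<lambda>n. c n + d n) \<le> (\<Sum>n. norm (c n) + norm (d n))"
    unfolding l1_norm_def using assms
    by (intro suminf_le norm_triangle_ineq summable add summable_add)
  also have "\<dots> = l1_norm c + l1_norm d"
    unfolding l1_norm_def using assms by (simp add: suminf_add summable)
  finally show ?thesis .
qed

lemma l1_norm_smult: "c \<in> S \<Longrightarrow> l1_norm (\<lambda>n. a * c n) = norm a * l1_norm c"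
  unfolding l1_norm_def by (simp add: norm_mult suminf_mult summable)

lemma l1_norm_nonneg: "c \<in> S \<Longrightarrow> 0 \<le> l1_norm c"
  unfolding l1_norm_def by (simp add: suminf_nonneg summable)

lemma l1_norm_eq_0: "c \<in> S \<Longrightarrow> l1_norm c = 0 \<longleftrightarrow> c = (\<lambda>n. 0)"
  unfolding l1_norm_def by (auto simp: suminf_eq_zero_iff summable)

lemma vec_seq_space: "vector_space_on (seq_space j S)"
  unfolding vector_space_on_def
proof (rule moduleI)
  show "cring (scalar_space :: ('k, 'k) tvs)" by (rule cring_scalar_space)
  show "abelian_group (seq_space j S)"
  proof (rule abelian_groupI)
    fix u assume "u \<in> carrier (seq_space j S)"
    then obtain c where c: "u = j c" "c \<in> S" by auto
    then show "\<exists>v\<in>carrier (seq_space j S). v \<oplus>\<^bsub>seq_space j S\<^esub> u = \<zero>\<^bsub>seq_space j S\<^esub>"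
      using smult[OF c(2), of "-1"] by (intro bexI[of _ "j (\<lambda>n. -1 * c n)"]) auto
  qed (auto simp: zero add ac_simps)
qed (auto simp: smult algebra_simps)

lemma norm_on_seq_space: "norm_on (seq_space j S) (\<lambda>u. l1_norm (the_inv j u))"
  unfolding norm_on_def
  using inj by (auto simp: l1_norm_nonneg l1_norm_eq_0 l1_norm_smult l1_norm_add inj_eq)

sublocale space: normed "seq_space j S" "\<lambda>u. l1_norm (the_inv j u)"
  using vec_seq_space norm_on_seq_space topo_seq_space by unfold_locales

lemma l1_norm_unit_vector: "l1_norm (unit_vector k :: nat \<Rightarrow> 'k) = 1"
proof -
  have "(\<lambda>n. norm (unit_vector k n :: 'k)) sums (\<Sum>n\<in>{k}. norm (unit_vector k n :: 'k))"
    by (rule sums_finite) (simp_all add: unit_vector_def)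
  then show ?thesis unfolding l1_norm_def by (simp add: sums_iff unit_vector_def)
qed

end

lemma the_inv_ident: "the_inv (\<lambda>c. c) = (\<lambda>c. c)"
  by (rule ext) (rule the_inv_f_f, simp)

lemma l1_eq_seq_space: "l1 = seq_space (\<lambda>c. c) {c. summable (\<lambda>n. norm (c n))}"
  by (simp add: l1_def seq_space_def Let_def the_inv_ident)

lemma seq_copy_l1:
  assumes "inj j" shows "seq_copy j {c :: nat \<Rightarrow> 'k::real_or_complex. summable (\<lambda>n. norm (c n))}"
proof
  fix c d :: "nat \<Rightarrow> 'k"
  assume "c \<in> {c. summable (\<lambda>n. norm (c n))}" "d \<in> {c. summable (\<lambda>n. norm (c n))}"
  then have "summable (\<lambda>n. norm (c n) + norm (d n))" by (intro summable_add) auto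
  then have "summable (\<lambda>n. norm (c n + d n))"
    by (rule summable_comparison_test'[where N = 0]) (simp add: norm_triangle_ineq)
  then show "(\<lambda>n. c n + d n) \<in> {c. summable (\<lambda>n. norm (c n))}" by simp
next
  show "unit_vector k \<in> {c :: nat \<Rightarrow> 'k. summable (\<lambda>n. norm (c n))}" for k
    using summable_finite[of "{k}" "\<lambda>n. norm (unit_vector k n :: 'k)"] by (simp add: unit_vector_def)
qed (auto simp: assms norm_mult summable_mult)

abbreviation finite_seqs :: "(nat \<Rightarrow> 'k::real_or_complex) set" where
  "finite_seqs \<equiv> {c. finite {n. c n \<noteq> 0}}"

lemma seq_copy_finite_seqs:
  assumes "inj j" shows "seq_copy j (finite_seqs :: (nat \<Rightarrow> 'k::real_or_complex) set)"
proof
  fix c d :: "nat \<Rightarrow> 'k"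
  assume "c \<in> finite_seqs" "d \<in> finite_seqs"
  then have "finite ({n. c n \<noteq> 0} \<union> {n. d n \<noteq> 0})" by simp
  moreover have "{n. c n + d n \<noteq> 0} \<subseteq> {n. c n \<noteq> 0} \<union> {n. d n \<noteq> 0}" by auto
  ultimately show "(\<lambda>n. c n + d n) \<in> finite_seqs" using finite_subset by blast
next
  fix c :: "nat \<Rightarrow> 'k"
  assume "c \<in> finite_seqs"
  then show "summable (\<lambda>n. norm (c n))" by (intro summable_finite) auto
next
  fix a and c :: "nat \<Rightarrow> 'k"
  assume "c \<in> finite_seqs"
  then show "(\<lambda>n. a * c n) \<in> finite_seqs" by (auto elim: rev_finite_subset)
qed (auto simp: assms unit_vector_def)

text \<open>
A finitely supported sequence is reached from zero by adding one multiple of a unit vector at a time.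
\<close>

lemma linear_span_unit_vectors:
  "linear_span_in l1 (range unit_vector) = (finite_seqs :: (nat \<Rightarrow> 'k::real_or_complex) set)"
proof -
  interpret seq_copy "\<lambda>c. c" "{c :: nat \<Rightarrow> 'k. summable (\<lambda>n. norm (c n))}"
    by (rule seq_copy_l1) simp
  interpret fin: seq_copy "\<lambda>c. c" "finite_seqs :: (nat \<Rightarrow> 'k) set"
    by (rule seq_copy_finite_seqs) simp
  interpret l1: vec "l1 :: ('k, nat \<Rightarrow> 'k) tvs"
    unfolding l1_eq_seq_space by (rule space.vec_axioms)
  have sub: "submodule finite_seqs scalar_space (l1 :: ('k, nat \<Rightarrow> 'k) tvs)"
  proof (rule l1.M.submoduleI)
    show "finite_seqs \<subseteq> carrier (l1 :: ('k, nat \<Rightarrow> 'k) tvs)"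
      using fin.summable by (auto simp: l1_eq_seq_space)
    then show "\<ominus>\<^bsub>l1\<^esub> c \<in> finite_seqs" if "c \<in> finite_seqs" for c :: "nat \<Rightarrow> 'k"
      using l1.uminus_eq[of c] fin.smult[OF that, of "-1"] that by (auto simp: l1_eq_seq_space the_inv_ident)
  qed (use fin.add fin.smult in \<open>auto simp: l1_eq_seq_space id\<close>)
  have least: "c \<in> H"
    if H: "submodule H scalar_space (l1 :: ('k, nat \<Rightarrow> 'k) tvs)" "range unit_vector \<subseteq> H"
      and c: "c \<in> finite_seqs" for H c
  proof -
    note H_closed = l1.M.submoduleE[OF H(1)]
    have cut: "(\<lambda>n. if n < m then c n else 0) \<in> H" for m
    proof (induction m)
      case 0
      have "0 \<odot>\<^bsub>l1\<^esub> unit_vector 0 \<in> H" using H(2) by (intro H_closed(4)) auto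
      then show ?case by (simp add: l1_eq_seq_space the_inv_ident)
    next
      case (Suc m)
      have "(\<lambda>n. if n < m then c n else 0) \<oplus>\<^bsub>l1\<^esub> (c m \<odot>\<^bsub>l1\<^esub> unit_vector m) \<in> H"
        using H(2) Suc by (intro H_closed(4,5)) auto
      moreover have "(\<lambda>n. if n < m then c n else 0) \<oplus>\<^bsub>l1\<^esub> (c m \<odot>\<^bsub>l1\<^esub> unit_vector m) =
          (\<lambda>n. if n < Suc m then c n else 0)"
        by (auto simp: l1_eq_seq_space the_inv_ident unit_vector_def fun_eq_iff less_Suc_eq)
      ultimately show ?case by simp
    qed
    obtain m where "\<And>n. c n \<noteq> 0 \<Longrightarrow> n < m"
      using c finite_nat_bounded[of "{n. c n \<noteq> 0}"] by blast
    then have "(\<lambda>n. if n < m then c n else 0) = c" by (auto simp: fun_eq_iff)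
    then show ?thesis using cut[of m] by simp
  qed
  show ?thesis
    unfolding linear_span_in_def using sub fin.unit least by blast
qed

lemma l1_0_eq_seq_space:
  "(l1_0 :: ('k::real_or_complex, nat \<Rightarrow> 'k) tvs) = seq_space (\<lambda>c. c) finite_seqs"
proof -
  have "l1_0 = (l1 \<lparr>carrier := finite_seqs\<rparr> :: ('k, nat \<Rightarrow> 'k) tvs)
      \<lparr>topo := norm_topology (l1 \<lparr>carrier := finite_seqs\<rparr>) l1_norm\<rparr>"
    by (simp add: l1_0_def linear_span_unit_vectors Let_def)
  also have "norm_topology (l1 \<lparr>carrier := finite_seqs\<rparr> :: ('k, nat \<Rightarrow> 'k) tvs) l1_norm =
      norm_topology (seq_space (\<lambda>c. c) finite_seqs) l1_norm"
    by (rule norm_topology_cong) (simp_all add: l1_def Let_def the_inv_ident)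
  also have "\<dots> = topo (seq_space (\<lambda>c. c) finite_seqs)"
    by (simp add: topo_seq_space the_inv_ident)
  finally show ?thesis
    by (simp add: l1_def seq_space_def Let_def the_inv_ident)
qed

section \<open>Operators with prescribed values on the unit vectors\<close>

text \<open>
Convergence of the series is an assumption here because the reasons differ: on finitely
supported sequences it is trivial, on \<open>l1\<close> it rests on local completeness.
\<close>

locale bounded_sequence_operator = lcs E + seq_copy j S
  for E :: "('k::real_or_complex, 'a) tvs" (structure)
    and j :: "(nat \<Rightarrow> 'k) \<Rightarrow> 'y" and S +
  fixes x :: "nat \<Rightarrow> 'a"
  assumes x: "\<And>n. x n \<in> carrier E"
    and bounded: "\<And>q. cont_seminorm q \<Longrightarrow> \<exists>M. \<forall>n. q (x n) \<le> M"
    and convergent: "\<And>c. c \<in> S \<Longrightarrow> \<exists>l. limitin (topo E) (partial_sum E x c) l sequentially"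
begin

definition T :: "'y \<Rightarrow> 'a" where
  "T u = (SOME l. limitin (topo E) (partial_sum E x (the_inv j u)) l sequentially)"

lemma T_limit: "c \<in> S \<Longrightarrow> limitin (topo E) (partial_sum E x c) (T (j c)) sequentially"
  unfolding T_def the_inv_j by (rule someI_ex[OF convergent])

lemma T_unit_vector: "T (j (unit_vector k)) = x k"
proof (rule limitin_unique[OF T_limit[OF unit]])
  show "limitin (topo E) (partial_sum E x (unit_vector k)) (x k) sequentially"
    unfolding partial_sum_unit_vector[where x = x and k = k, OF x, symmetric]
    by (rule partial_sum_finite_support[where x = x, OF x]) (simp add: unit_vector_def)
qed

lemma T_seminorm_le:
  assumes "cont_seminorm q" "\<And>n. q (x n) \<le> M" "c \<in> S"
  shows "q (T (j c)) \<le> M * l1_norm c"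
  using seminorm_series_le[OF assms(1) x assms(2) summable[OF assms(3)] T_limit[OF assms(3)]] .

lemma T_operator: "operator (seq_space j S) E T"
proof (rule operator_from_normedI)
  show "normed (seq_space j S) (\<lambda>u. l1_norm (the_inv j u))" by (rule space.normed_axioms)
  show "linear_map_on (seq_space j S) E T"
    unfolding linear_map_on_def
  proof (intro conjI ballI allI)
    show "T \<in> carrier (seq_space j S) \<rightarrow> carrier E"
      using T_limit by (force simp: limitin_def)
  next
    fix u v assume "u \<in> carrier (seq_space j S)" "v \<in> carrier (seq_space j S)"
    then obtain c d where c: "u = j c" "c \<in> S" and d: "v = j d" "d \<in> S" by auto
    have "limitin (topo E) (partial_sum E x (\<lambda>n. c n + d n)) (T u \<oplus> T v) sequentially"
      using limitin_add[OF T_limit[OF c(2)] T_limit[OF d(2)]] c(1) d(1)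
      by (simp add: partial_sum_add[OF x, symmetric])
    from limitin_unique[OF T_limit[OF add[OF c(2) d(2)]] this]
    show "T (u \<oplus>\<^bsub>seq_space j S\<^esub> v) = T u \<oplus> T v" using c(1) d(1) by simp
  next
    fix a u assume "u \<in> carrier (seq_space j S)"
    then obtain c where c: "u = j c" "c \<in> S" by auto
    have "limitin (topo E) (partial_sum E x (\<lambda>n. a * c n)) (a \<odot> T u) sequentially"
      using limitin_smult[OF T_limit[OF c(2)], of a] c(1)
      by (simp add: partial_sum_smult[OF x, symmetric])
    from limitin_unique[OF T_limit[OF smult[OF c(2)]] this]
    show "T (a \<odot>\<^bsub>seq_space j S\<^esub> u) = a \<odot> T u" using c(1) by simp
  qed
  fix q assume q: "cont_seminorm q"
  then obtain M where "\<And>n. q (x n) \<le> M" using bounded by blast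
  then show "\<exists>C. \<forall>u\<in>carrier (seq_space j S). q (T u) \<le> C * l1_norm (the_inv j u)"
    using T_seminorm_le[OF q] by auto
qed

text \<open>
A neighbourhood of zero contains a common multiple of all unit vectors, because these have norm 1.
\<close>

lemma T_image_contains_multiples:
  assumes "zero_nbhd (seq_space j S) U"
  obtains c where "c \<noteq> 0" "\<And>n. c \<odot> x n \<in> T ` U"
proof -
  obtain r where r: "0 < r" "\<And>u. u \<in> carrier (seq_space j S) \<Longrightarrow> l1_norm (the_inv j u) < r \<Longrightarrow> u \<in> U"
    using space.zero_nbhd_contains_ball[OF assms] by blast
  let ?c = "of_real (r/2) :: 'k"
  show ?thesis
  proof (rule that[of ?c])
    show "?c \<noteq> 0" using r(1) by simp
    fix n
    let ?u = "?c \<odot>\<^bsub>seq_space j S\<^esub> j (unit_vector n)"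
    have uc: "j (unit_vector n) \<in> carrier (seq_space j S)" using unit by simp
    have "l1_norm (the_inv j ?u) = r/2"
      using r(1) l1_norm_smult[OF unit, of ?c n] by (simp add: l1_norm_unit_vector norm_divide)
    moreover have "?u \<in> carrier (seq_space j S)" using smult[OF unit, of ?c n] by simp
    ultimately have "?u \<in> U" using r(1) by (intro r(2)) simp_all
    moreover have "T ?u = ?c \<odot> x n"
      using T_operator uc by (simp only: operator_def linear_map_on_def T_unit_vector)
    ultimately show "?c \<odot> x n \<in> T ` U" by (metis imageI)
  qed
qed

end

text \<open>
For absolutely summable coefficients this follows from local completeness; for finitely supported
ones it always holds.
\<close>

definition (in lcs) series_converge_on :: "(nat \<Rightarrow> 'k) set \<Rightarrow> bool" where
  "series_converge_on S \<longleftrightarrow> (\<forall>x. (\<forall>n. x n \<in> carrier E) \<longrightarrow>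
     (\<forall>q. cont_seminorm q \<longrightarrow> (\<exists>M. \<forall>n. q (x n) \<le> M)) \<longrightarrow>
     (\<forall>c\<in>S. \<exists>l. limitin (topo E) (partial_sum E x c) l sequentially))"

text \<open>
The operator sending the unit vectors to \<open>x\<close> is dominated by \<open>A\<close> because \<open>c \<mapsto> norm (\<phi> (T c))\<close> is
estimated by the bound of the continuous seminorm \<open>norm \<circ> \<phi>\<close> on the sequence \<open>x\<close>.
\<close>

lemma (in lcs) operator_through_p_Vstar_sequence:
  fixes x :: "nat \<Rightarrow> 'a"
  assumes copy: "seq_copy j S" and p: "1 \<le> p" and A: "p_Vstar_set p E A" and xA: "range x \<subseteq> A"
    and conv: "series_converge_on S"
  shows "\<exists>T. operator (seq_space j S) E T \<and>
    p_convergent p (strong_dual E) (strong_dual (seq_space j S)) (adjoint_map (seq_space j S) T) \<and>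
    (\<forall>U. zero_nbhd (seq_space j S) U \<longrightarrow> (\<exists>c. c \<noteq> 0 \<and> (\<forall>n. c \<odot> x n \<in> T ` U)))"
proof -
  have xc: "x n \<in> carrier E" for n using xA A by (auto simp: p_Vstar_set_def)
  have bd: "\<exists>M. \<forall>n. q (x n) \<le> M" if "cont_seminorm q" for q
    using seminorm_bounded_if_p_Vstar_set[OF p A that] xA by blast
  interpret seq_copy j S by fact
  interpret bounded_sequence_operator E j S x
    using xc bd conv unfolding series_converge_on_def by unfold_locales blast+
  have "p_convergent p (strong_dual E) (strong_dual (seq_space j S)) (adjoint_map (seq_space j S) T)"
  proof (rule space.p_convergent_adjointI[OF T_operator A])
    fix \<phi> M u assume \<phi>: "\<phi> \<in> dual E" and M: "\<forall>a\<in>A. norm (\<phi> a) \<le> M"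
      and "u \<in> carrier (seq_space j S)"
    then obtain c where c: "u = j c" "c \<in> S" by auto
    have "norm (\<phi> (x n)) \<le> M" for n using M xA by auto
    then show "norm (\<phi> (T u)) \<le> M * l1_norm (the_inv j u)"
      using T_seminorm_le[OF cont_seminorm_dual[OF \<phi>] _ c(2)] c(1) by simp
  qed
  moreover have "\<exists>c. c \<noteq> 0 \<and> (\<forall>n. c \<odot> x n \<in> T ` U)" if "zero_nbhd (seq_space j S) U" for U
    by (rule T_image_contains_multiples[OF that]) (intro exI conjI allI)
  ultimately show ?thesis using T_operator by (intro exI[of _ T] conjI allI impI)
qed

section \<open>The equivalence\<close>

lemma operator_condition_if_wsVstar:
  assumes "property_wsVstar p E" "normed_space Y"
  shows "adjoint_p_convergent_implies p weakly_seq_precompact_operator Y E"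
  unfolding adjoint_p_convergent_implies_def
proof (intro allI impI, elim conjE)
  obtain N where "normed Y N" using assms(2) by (rule normed_spaceE)
  then interpret normed Y N .
  fix T assume T: "operator Y E T"
    "p_convergent p (strong_dual E) (strong_dual Y) (adjoint_map Y T)"
  then have "weakly_seq_precompact E (T ` {y \<in> carrier Y. N y < 1})"
    using p_Vstar_set_image_ball assms(1) by (auto simp: property_wsVstar_def)
  then show "weakly_seq_precompact_operator Y E T"
    using T(1) zero_nbhd_ball[of 1] by (auto simp: weakly_seq_precompact_operator_def)
qed

lemma operator_condition_if_sVstar:
  assumes "property_sVstar p E" "normed_space Y"
  shows "adjoint_p_convergent_implies p weakly_seq_compact_operator Y E"
  unfolding adjoint_p_convergent_implies_def
proof (intro allI impI, elim conjE)
  obtain N where "normed Y N" using assms(2) by (rule normed_spaceE)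
  then interpret normed Y N .
  fix T assume T: "operator Y E T"
    "p_convergent p (strong_dual E) (strong_dual Y) (adjoint_map Y T)"
  then have "rel_weakly_seq_compact E (T ` {y \<in> carrier Y. N y < 1})"
    using p_Vstar_set_image_ball assms(1) by (auto simp: property_sVstar_def)
  then show "weakly_seq_compact_operator Y E T"
    using T(1) zero_nbhd_ball[of 1] by (auto simp: weakly_seq_compact_operator_def)
qed

context lcs
begin

lemma wsVstar_if_operator_condition:
  assumes "1 \<le> p" "seq_copy j S" "series_converge_on S"
    and cond: "adjoint_p_convergent_implies p weakly_seq_precompact_operator (seq_space j S) E"
  shows "property_wsVstar p E"
  unfolding property_wsVstar_def weakly_seq_precompact_def
proof (intro allI impI conjI)
  fix A assume A: "p_Vstar_set p E A"
  then show AE: "A \<subseteq> carrier E" by (simp add: p_Vstar_set_def)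
  fix x :: "nat \<Rightarrow> 'a" assume x: "range x \<subseteq> A"
  from operator_through_p_Vstar_sequence[OF assms(2,1) A x assms(3)]
  obtain T where T: "operator (seq_space j S) E T"
    "p_convergent p (strong_dual E) (strong_dual (seq_space j S)) (adjoint_map (seq_space j S) T)"
    "\<forall>U. zero_nbhd (seq_space j S) U \<longrightarrow> (\<exists>c. c \<noteq> 0 \<and> (\<forall>n. c \<odot> x n \<in> T ` U))"
    by (elim exE conjE)
  then have "weakly_seq_precompact_operator (seq_space j S) E T"
    using cond by (simp add: adjoint_p_convergent_implies_def)
  then obtain U where U: "zero_nbhd (seq_space j S) U" "weakly_seq_precompact E (T ` U)"
    by (auto simp: weakly_seq_precompact_operator_def)
  obtain c where c: "c \<noteq> 0" "\<And>n. c \<odot> x n \<in> T ` U" using T(3) U(1) by blast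
  show "\<exists>r. strict_mono r \<and> weakly_Cauchy E (x \<circ> r)"
    by (rule weakly_seq_precompact_smultD[OF U(2) order_trans[OF x AE] c])
qed

lemma sVstar_if_operator_condition:
  assumes "1 \<le> p" "seq_copy j S" "series_converge_on S"
    and cond: "adjoint_p_convergent_implies p weakly_seq_compact_operator (seq_space j S) E"
  shows "property_sVstar p E"
  unfolding property_sVstar_def rel_weakly_seq_compact_def
proof (intro allI impI conjI)
  fix A assume A: "p_Vstar_set p E A"
  then show AE: "A \<subseteq> carrier E" by (simp add: p_Vstar_set_def)
  fix x :: "nat \<Rightarrow> 'a" assume x: "range x \<subseteq> A"
  from operator_through_p_Vstar_sequence[OF assms(2,1) A x assms(3)]
  obtain T where T: "operator (seq_space j S) E T"
    "p_convergent p (strong_dual E) (strong_dual (seq_space j S)) (adjoint_map (seq_space j S) T)"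
    "\<forall>U. zero_nbhd (seq_space j S) U \<longrightarrow> (\<exists>c. c \<noteq> 0 \<and> (\<forall>n. c \<odot> x n \<in> T ` U))"
    by (elim exE conjE)
  then have "weakly_seq_compact_operator (seq_space j S) E T"
    using cond by (simp add: adjoint_p_convergent_implies_def)
  then obtain U where U: "zero_nbhd (seq_space j S) U" "rel_weakly_seq_compact E (T ` U)"
    by (auto simp: weakly_seq_compact_operator_def)
  obtain c where c: "c \<noteq> 0" "\<And>n. c \<odot> x n \<in> T ` U" using T(3) U(1) by blast
  show "\<exists>r. strict_mono r \<and> (\<exists>l\<in>carrier E. limitin (weak_topology E) (x \<circ> r) l sequentially)"
    by (rule rel_weakly_seq_compact_smultD[OF U(2) order_trans[OF x AE] c])
qed

lemma series_converge_on_finite_seqs: "series_converge_on finite_seqs"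
  unfolding series_converge_on_def
proof (intro allI impI ballI)
  fix x :: "nat \<Rightarrow> 'a" and c :: "nat \<Rightarrow> 'k"
  assume x: "\<forall>n. x n \<in> carrier E" and "c \<in> finite_seqs"
  then obtain m where "\<And>n. c n \<noteq> 0 \<Longrightarrow> n < m"
    using finite_nat_bounded[of "{n. c n \<noteq> 0}"] by blast
  then have "c n = 0" if "n \<ge> m" for n using that by fastforce
  then show "\<exists>l. limitin (topo E) (partial_sum E x c) l sequentially"
    using partial_sum_finite_support[of x m c] x by blast
qed

lemma series_converge_on_l1:
  assumes "locally_complete E"
  shows "series_converge_on {c. summable (\<lambda>n. norm (c n))}"
  unfolding series_converge_on_def
proof (intro allI impI ballI)
  fix x :: "nat \<Rightarrow> 'a" and c :: "nat \<Rightarrow> 'k"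
  assume x: "\<forall>n. x n \<in> carrier E" "\<forall>q. cont_seminorm q \<longrightarrow> (\<exists>M. \<forall>n. q (x n) \<le> M)"
    "c \<in> {c. summable (\<lambda>n. norm (c n))}"
  then have c: "summable (\<lambda>n. norm (c n))" by simp
  show "\<exists>l. limitin (topo E) (partial_sum E x c) l sequentially"
    by (rule locally_complete_series_convergent[where x = x, OF assms _ _ c])
      (simp_all only: x[rule_format], rule exI)
qed

end

theorem theorem14p11:
  fixes E :: "('k::real_or_complex, 'a) tvs" and p :: ereal
  assumes "1 \<le> p" and "locally_convex_space E"
    \<comment> \<open>The type carrying the normed spaces \<open>Y\<close> below is arbitrary, but not too small.\<close>
    and "(UNIV :: (nat \<Rightarrow> 'k) set) \<lesssim> (UNIV :: 'y set)"
  shows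
    "((\<forall>Y :: ('k, 'y) tvs. normed_space Y \<longrightarrow>
          adjoint_p_convergent_implies p weakly_seq_precompact_operator Y E)
        \<longleftrightarrow> adjoint_p_convergent_implies p weakly_seq_precompact_operator l1_0 E) \<and>
     (adjoint_p_convergent_implies p weakly_seq_precompact_operator l1_0 E
        \<longleftrightarrow> property_wsVstar p E) \<and>
     (locally_complete E \<longrightarrow>
        (property_wsVstar p E
        \<longleftrightarrow> adjoint_p_convergent_implies p weakly_seq_precompact_operator l1 E)) \<and>

     ((\<forall>Y :: ('k, 'y) tvs. normed_space Y \<longrightarrow>
          adjoint_p_convergent_implies p weakly_seq_compact_operator Y E)
        \<longleftrightarrow> adjoint_p_convergent_implies p weakly_seq_compact_operator l1_0 E) \<and>
     (adjoint_p_convergent_implies p weakly_seq_compact_operator l1_0 E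
        \<longleftrightarrow> property_sVstar p E) \<and>
     (locally_complete E \<longrightarrow>
        (property_sVstar p E
        \<longleftrightarrow> adjoint_p_convergent_implies p weakly_seq_compact_operator l1 E))"
proof -
  interpret lcs E using assms(2) by (rule lcsI)
  obtain j :: "(nat \<Rightarrow> 'k) \<Rightarrow> 'y" where j: "inj j"
    using assms(3) by (auto simp: lepoll_def)
  interpret Y: seq_copy j finite_seqs using j by (rule seq_copy_finite_seqs)
  interpret l1_0: seq_copy "\<lambda>c :: nat \<Rightarrow> 'k. c" finite_seqs by (rule seq_copy_finite_seqs) simp
  interpret l1: seq_copy "\<lambda>c :: nat \<Rightarrow> 'k. c" "{c. summable (\<lambda>n. norm (c n))}"
    by (rule seq_copy_l1) simp
  note normed = Y.space.normed_space l1_0.space.normed_space[folded l1_0_eq_seq_space]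
    l1.space.normed_space[folded l1_eq_seq_space]
  note to_ws = wsVstar_if_operator_condition[OF assms(1)]
  note to_s = sVstar_if_operator_condition[OF assms(1)]
  have ws:
    "\<forall>Y :: ('k, 'y) tvs. normed_space Y \<longrightarrow>
      adjoint_p_convergent_implies p weakly_seq_precompact_operator Y E \<Longrightarrow> property_wsVstar p E"
    "adjoint_p_convergent_implies p weakly_seq_precompact_operator l1_0 E \<Longrightarrow> property_wsVstar p E"
    "locally_complete E \<Longrightarrow> adjoint_p_convergent_implies p weakly_seq_precompact_operator l1 E \<Longrightarrow>
      property_wsVstar p E"
    subgoal using to_ws[OF Y.seq_copy_axioms series_converge_on_finite_seqs] normed(1) by simp
    subgoal using to_ws[OF l1_0.seq_copy_axioms series_converge_on_finite_seqs]
      by (simp add: l1_0_eq_seq_space)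
    subgoal using to_ws[OF l1.seq_copy_axioms series_converge_on_l1] by (simp add: l1_eq_seq_space)
    done
  have s:
    "\<forall>Y :: ('k, 'y) tvs. normed_space Y \<longrightarrow>
      adjoint_p_convergent_implies p weakly_seq_compact_operator Y E \<Longrightarrow> property_sVstar p E"
    "adjoint_p_convergent_implies p weakly_seq_compact_operator l1_0 E \<Longrightarrow> property_sVstar p E"
    "locally_complete E \<Longrightarrow> adjoint_p_convergent_implies p weakly_seq_compact_operator l1 E \<Longrightarrow>
      property_sVstar p E"
    subgoal using to_s[OF Y.seq_copy_axioms series_converge_on_finite_seqs] normed(1) by simp
    subgoal using to_s[OF l1_0.seq_copy_axioms series_converge_on_finite_seqs]
      by (simp add: l1_0_eq_seq_space)
    subgoal using to_s[OF l1.seq_copy_axioms series_converge_on_l1] by (simp add: l1_eq_seq_space)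
    done
  note from_ws = operator_condition_if_wsVstar and from_s = operator_condition_if_sVstar
  show ?thesis
    apply (intro conjI impI iffI allI)
    subgoal by (rule from_ws[OF ws(1) normed(2)])
    subgoal by (rule from_ws[OF ws(2)])
    subgoal by (rule ws(2))
    subgoal by (rule from_ws[OF _ normed(2)])
    subgoal by (rule from_ws[OF _ normed(3)])
    subgoal by (rule ws(3))
    subgoal by (rule from_s[OF s(1) normed(2)])
    subgoal by (rule from_s[OF s(2)])
    subgoal by (rule s(2))
    subgoal by (rule from_s[OF _ normed(2)])
    subgoal by (rule from_s[OF _ normed(3)])
    subgoal by (rule s(3))
    done
qed

end
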